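(* Let $G=(V,E)$ be a finite directed graph with $n$ nodes and $m$ edges, and let $(S_1^{\ast},S_2^{\ast})$ be a pair of nonempty subsets of $V$ maximizing $\mathrm{d}(S_1,S_2)=|E(S_1,S_2)|/\sqrt{|S_1||S_2|}$. Suppose we are given $S_1,S_2\subseteq V$ and parameters $\epsilon_1,\epsilon_2$ such that for $i=1,2$: (1) $|S_i\cap S_i^{\ast}|\ge (1-\epsilon_i)|S_i^{\ast}|$, and (2) $|S_i\setminus S_i^{\ast}|\le \epsilon_i|S_i^{\ast}|$. Then, with $\epsilon=\max\{\epsilon_1,\epsilon_2\}$, there exists an $O(m)$ time algorithm that finds a pair $(T_1,T_2)$ of subsets of $V$ with $\mathrm{d}(T_1,T_2)\ge (1-O(\epsilon))\,\mathrm{d}(S_1^{\ast},S_2^{\ast})$.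
   Context: For $A,B\subseteq V$ (not necessarily disjoint), $E(A,B)$ denotes the set of directed edges $u\to v$ of $G$ with $u\in A$ and $v\in B$. The directed densest subgraph problem asks for a pair $(S_1,S_2)$ of nonempty subsets maximizing $\mathrm{d}(S_1,S_2)=|E(S_1,S_2)|/\sqrt{|S_1||S_2|}$. *)

theory Defs
  imports
    "HOL-Library.Landau_Symbols"
    "Graph_Theory.Pair_Digraph"
begin

section \<open>Directed densest subgraph\<close>

definition edges_between :: "'a pair_pre_digraph \<Rightarrow> 'a set \<Rightarrow> 'a set \<Rightarrow> ('a \<times> 'a) set" where
  "edges_between G A B = {(u, v) \<in> parcs G. u \<in> A \<and> v \<in> B}"

definition density :: "'a pair_pre_digraph \<Rightarrow> 'a set \<Rightarrow> 'a set \<Rightarrow> real" where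
  "density G A B =
     real (card (edges_between G A B)) / sqrt (real (card A) * real (card B))"

definition densest_pair :: "'a pair_pre_digraph \<Rightarrow> 'a set \<Rightarrow> 'a set \<Rightarrow> bool" where
  "densest_pair G A B \<longleftrightarrow>
     is_arg_max (\<lambda>(A, B). density G A B)
       (\<lambda>(A, B). A \<subseteq> pverts G \<and> A \<noteq> {} \<and> B \<subseteq> pverts G \<and> B \<noteq> {})
       (A, B)"


section \<open>Random access machine with real registers\<close>

text \<open>
  Running times refer to programs in a structured form of the uniform-cost RAM. The memory consists
  of natural number registers and arrays with indirect addressing, and of registers holding exact
  real numbers as in the real RAM model. The natural numbers have only addition and truncated
  subtraction, so that unit cost cannot be exploited to build long numbers by repeated
  multiplication. There are no real constants, and no rounding from reals to naturals. Every
  expression node, assignment and test costs one unit.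
\<close>

type_synonym vname = string

record state =
  reg :: "vname \<Rightarrow> nat"
  arr :: "vname \<Rightarrow> nat \<Rightarrow> nat"
  rreg :: "vname \<Rightarrow> real"

datatype nexp =
    Const nat
  | Reg vname
  | Arr vname nexp
  | Add nexp nexp
  | Sub nexp nexp

datatype rexp =
    RNat nexp
  | RReg vname
  | RAdd rexp rexp
  | RSub rexp rexp
  | RMul rexp rexp
  | RDiv rexp rexp

datatype bexp =
    Less nexp nexp
  | RLess rexp rexp
  | Neg bexp
  | Conj bexp bexp

datatype com =
    Skip
  | Assign vname nexp
  | Store vname nexp nexp
  | RAssign vname rexp
  | Seq com com
  | If bexp com com
  | While bexp com

primrec nval :: "nexp \<Rightarrow> state \<Rightarrow> nat" where
  "nval (Const k) s = k"
| "nval (Reg x) s = reg s x"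
| "nval (Arr a e) s = arr s a (nval e s)"
| "nval (Add e f) s = nval e s + nval f s"
| "nval (Sub e f) s = nval e s - nval f s"

primrec rval :: "rexp \<Rightarrow> state \<Rightarrow> real" where
  "rval (RNat e) s = real (nval e s)"
| "rval (RReg x) s = rreg s x"
| "rval (RAdd e f) s = rval e s + rval f s"
| "rval (RSub e f) s = rval e s - rval f s"
| "rval (RMul e f) s = rval e s * rval f s"
| "rval (RDiv e f) s = rval e s / rval f s"

primrec bval :: "bexp \<Rightarrow> state \<Rightarrow> bool" where
  "bval (Less e f) s \<longleftrightarrow> nval e s < nval f s"
| "bval (RLess e f) s \<longleftrightarrow> rval e s < rval f s"
| "bval (Neg b) s \<longleftrightarrow> \<not> bval b s"
| "bval (Conj b c) s \<longleftrightarrow> bval b s \<and> bval c s"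

primrec ncost :: "nexp \<Rightarrow> nat" where
  "ncost (Const k) = 1"
| "ncost (Reg x) = 1"
| "ncost (Arr a e) = ncost e + 1"
| "ncost (Add e f) = ncost e + ncost f + 1"
| "ncost (Sub e f) = ncost e + ncost f + 1"

primrec rcost :: "rexp \<Rightarrow> nat" where
  "rcost (RNat e) = ncost e + 1"
| "rcost (RReg x) = 1"
| "rcost (RAdd e f) = rcost e + rcost f + 1"
| "rcost (RSub e f) = rcost e + rcost f + 1"
| "rcost (RMul e f) = rcost e + rcost f + 1"
| "rcost (RDiv e f) = rcost e + rcost f + 1"

primrec bcost :: "bexp \<Rightarrow> nat" where
  "bcost (Less e f) = ncost e + ncost f + 1"
| "bcost (RLess e f) = rcost e + rcost f + 1"
| "bcost (Neg b) = bcost b + 1"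
| "bcost (Conj b c) = bcost b + bcost c + 1"

text \<open>
  \<open>exec p s t s'\<close> states that \<open>p\<close>, started in \<open>s\<close>, terminates in \<open>s'\<close> after \<open>t\<close> time units.
\<close>

inductive exec :: "com \<Rightarrow> state \<Rightarrow> nat \<Rightarrow> state \<Rightarrow> bool" where
  exec_Skip: "exec Skip s 1 s"
| exec_Assign:
    "exec (Assign x e) s (ncost e + 1) (s\<lparr>reg := (reg s)(x := nval e s)\<rparr>)"
| exec_Store:
    "exec (Store a i e) s (ncost i + ncost e + 1)
       (s\<lparr>arr := (arr s)(a := (arr s a)(nval i s := nval e s))\<rparr>)"
| exec_RAssign:
    "exec (RAssign x e) s (rcost e + 1) (s\<lparr>rreg := (rreg s)(x := rval e s)\<rparr>)"
| exec_Seq: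
    "exec p s t s' \<Longrightarrow> exec q s' u s'' \<Longrightarrow> exec (Seq p q) s (t + u) s''"
| exec_IfTrue:
    "bval b s \<Longrightarrow> exec p s t s' \<Longrightarrow> exec (If b p q) s (bcost b + 1 + t) s'"
| exec_IfFalse:
    "\<not> bval b s \<Longrightarrow> exec q s t s' \<Longrightarrow> exec (If b p q) s (bcost b + 1 + t) s'"
| exec_WhileFalse:
    "\<not> bval b s \<Longrightarrow> exec (While b p) s (bcost b + 1) s"
| exec_WhileTrue:
    "bval b s \<Longrightarrow> exec p s t s' \<Longrightarrow> exec (While b p) s' u s'' \<Longrightarrow>
     exec (While b p) s (bcost b + 1 + t + u) s''"

inductive_cases exec_SkipE: "exec Skip s t s'"
inductive_cases exec_AssignE: "exec (Assign x e) s t s'"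
inductive_cases exec_StoreE: "exec (Store a i e) s t s'"
inductive_cases exec_RAssignE: "exec (RAssign x e) s t s'"
inductive_cases exec_SeqE: "exec (Seq p q) s t s'"
inductive_cases exec_IfE: "exec (If b p q) s t s'"
inductive_cases exec_WhileE: "exec (While b p) s t s'"

lemma exec_deterministic:
  "exec p s t s' \<Longrightarrow> exec p s u s'' \<Longrightarrow> u = t \<and> s'' = s'"
proof (induction arbitrary: u s'' rule: exec.induct)
  case (exec_Seq p s t s' q v s3)
  from exec_Seq.prems show ?case
    by (rule exec_SeqE) (auto dest!: exec_Seq.IH)
next
  case (exec_IfTrue b s p t s' q)
  from exec_IfTrue.prems show ?case
    by (rule exec_IfE) (auto simp: exec_IfTrue.hyps dest!: exec_IfTrue.IH)
next
  case (exec_IfFalse b s q t s' p)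
  from exec_IfFalse.prems show ?case
    by (rule exec_IfE) (auto simp: exec_IfFalse.hyps dest!: exec_IfFalse.IH)
next
  case (exec_WhileFalse b s p)
  from exec_WhileFalse.prems show ?case
    by (rule exec_WhileE) (auto simp: exec_WhileFalse.hyps)
next
  case (exec_WhileTrue b s p t s' v s3)
  from exec_WhileTrue.prems show ?case
    by (rule exec_WhileE) (auto simp: exec_WhileTrue.hyps dest!: exec_WhileTrue.IH)
qed (auto elim: exec_SkipE exec_AssignE exec_StoreE exec_RAssignE)


section \<open>Input and output conventions\<close>

text \<open>
  A set is stored under a name \<open>a\<close> as a list without repetitions, in any order: the length is
  in register \<open>a\<close>, the elements are in the initial segment of array \<open>a\<close>.
\<close>

definition stores_set :: "state \<Rightarrow> vname \<Rightarrow> nat set \<Rightarrow> bool" where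
  "stores_set s a A \<longleftrightarrow> bij_betw (arr s a) {..<reg s a} A"

text \<open>
  The graph is given as a list of its edges in any order. All memory not mentioned here has
  arbitrary initial contents, so a program has to pay for any initialization it relies on.
\<close>

definition stores_input ::
  "state \<Rightarrow> nat pair_pre_digraph \<Rightarrow> nat set \<Rightarrow> nat set \<Rightarrow> real \<Rightarrow> real \<Rightarrow> bool" where
  "stores_input s G S1 S2 \<epsilon>1 \<epsilon>2 \<longleftrightarrow>
     reg s ''n'' = card (pverts G) \<and>
     reg s ''m'' = card (parcs G) \<and>
     bij_betw (\<lambda>i. (arr s ''src'' i, arr s ''dst'' i)) {..<reg s ''m''} (parcs G) \<and>
     stores_set s ''S1'' S1 \<and>
     stores_set s ''S2'' S2 \<and>
     rreg s ''eps1'' = \<epsilon>1 \<and>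
     rreg s ''eps2'' = \<epsilon>2"

end

theory Submission
  imports Defs
begin

text \<open>
  Write \<open>S1*, S2*\<close> for the optimum. A vertex set of size at most \<open>\<epsilon> |S1*|\<close> and one of size at most
  \<open>\<epsilon> |S2*|\<close> span at most \<open>\<epsilon> |E(S1*, S2*)|\<close> edges, since they are no denser than the optimum.
  So all but an \<open>\<epsilon>\<close> fraction of the optimal edges have an endpoint on the correct side in \<open>S1\<close> or
  \<open>S2\<close>. Extend \<open>S1\<close> to \<open>T1\<close> by the vertices sending most edges into \<open>S2\<close>, up to
  \<open>|T1| \<le> |S1| / (1 - \<epsilon>1)\<close>; this is room enough for \<open>S1*\<close>. Then extend \<open>S2\<close> to \<open>T2\<close> by the
  vertices receiving most edges from \<open>T1\<close>. This captures \<open>(1 - \<epsilon>) |E(S1*, S2*)|\<close> edges while both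
  sides grow by a factor of at most \<open>(1 + \<epsilon>) / (1 - \<epsilon>)\<close>. The selection takes linear time because
  degrees are at most \<open>m\<close>: raising a degree to \<open>j\<close> increments a counter for the vertices of degree
  at least \<open>j\<close>, and these counters give the cut-off degree. When \<open>\<epsilon> \<ge> 1/3\<close> or there are no edges,
  any nonempty pair will do.
\<close>

section \<open>Hoare-style rules for termination within a time bound\<close>

section \<open>Timed total correctness\<close>

text \<open>\<open>T\<close> is only an upper bound, so costs may be rounded up generously. Because
  \<open>exec\<close> is deterministic, the run asserted here is the only one.\<close>

definition runs :: "com \<Rightarrow> state \<Rightarrow> nat \<Rightarrow> (state \<Rightarrow> bool) \<Rightarrow> bool" where
  "runs p s T Q \<longleftrightarrow> (\<exists>t s'. exec p s t s' \<and> t \<le> T \<and> Q s')"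

lemma runs_mono:
  "runs p s T Q \<Longrightarrow> T \<le> T' \<Longrightarrow> (\<And>s'. Q s' \<Longrightarrow> Q' s') \<Longrightarrow> runs p s T' Q'"
  unfolding runs_def by (meson order_trans)

text \<open>Determinism collapses the existential onto the known execution. Atomic commands thereby
  get equivalences that the simplifier can use for symbolic execution.\<close>

lemma runs_deterministic_step:
  assumes "exec p s t0 s0"
  shows "runs p s T Q \<longleftrightarrow> t0 \<le> T \<and> Q s0"
  unfolding runs_def using assms exec_deterministic by blast

lemma runs_Skip [simp]: "runs Skip s T Q \<longleftrightarrow> 1 \<le> T \<and> Q s"
  by (rule runs_deterministic_step[OF exec_Skip])

lemma runs_Assign [simp]:
  "runs (Assign x e) s T Q \<longleftrightarrow>
     ncost e + 1 \<le> T \<and> Q (s\<lparr>reg := (reg s)(x := nval e s)\<rparr>)"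
  by (rule runs_deterministic_step[OF exec_Assign])

lemma runs_Store [simp]:
  "runs (Store a i e) s T Q \<longleftrightarrow>
     ncost i + ncost e + 1 \<le> T \<and>
     Q (s\<lparr>arr := (arr s)(a := (arr s a)(nval i s := nval e s))\<rparr>)"
  by (rule runs_deterministic_step[OF exec_Store])

lemma runs_RAssign [simp]:
  "runs (RAssign x e) s T Q \<longleftrightarrow>
     rcost e + 1 \<le> T \<and> Q (s\<lparr>rreg := (rreg s)(x := rval e s)\<rparr>)"
  by (rule runs_deterministic_step[OF exec_RAssign])

lemma runs_Seq:
  assumes "runs p s T1 R" "\<And>s'. R s' \<Longrightarrow> runs q s' T2 Q" "T1 + T2 \<le> T"
  shows "runs (Seq p q) s T Q"
proof -
  from assms(1) obtain t s' where 1: "exec p s t s'" "t \<le> T1" "R s'"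
    unfolding runs_def by blast
  from assms(2)[OF 1(3)] obtain u s'' where 2: "exec q s' u s''" "u \<le> T2" "Q s''"
    unfolding runs_def by blast
  from exec_Seq[OF 1(1) 2(1)] 1(2) 2(2,3) assms(3) show ?thesis
    unfolding runs_def by (intro exI[of _ "t + u"] exI[of _ s'']) auto
qed

lemma runs_Seq_Assign [simp]:
  assumes "ncost e + 1 \<le> T"
    and "runs q (s\<lparr>reg := (reg s)(x := nval e s)\<rparr>) (T - (ncost e + 1)) Q"
  shows "runs (Seq (Assign x e) q) s T Q"
  using assms by (intro runs_Seq[where ?T1.0 = "ncost e + 1" and ?T2.0 = "T - (ncost e + 1)"
      and R = "\<lambda>s'. s' = s\<lparr>reg := (reg s)(x := nval e s)\<rparr>"]) auto

lemma runs_Seq_Store [simp]: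
  assumes "ncost i + ncost e + 1 \<le> T"
    and "runs q (s\<lparr>arr := (arr s)(a := (arr s a)(nval i s := nval e s))\<rparr>)
           (T - (ncost i + ncost e + 1)) Q"
  shows "runs (Seq (Store a i e) q) s T Q"
  using assms
  by (intro runs_Seq[where ?T1.0 = "ncost i + ncost e + 1" and ?T2.0 = "T - (ncost i + ncost e + 1)"
      and R = "\<lambda>s'. s' = s\<lparr>arr := (arr s)(a := (arr s a)(nval i s := nval e s))\<rparr>"]) auto

lemma runs_If [simp]:
  assumes "bcost b + 1 \<le> T"
    and "bval b s \<Longrightarrow> runs p s (T - (bcost b + 1)) Q"
    and "\<not> bval b s \<Longrightarrow> runs q s (T - (bcost b + 1)) Q"
  shows "runs (If b p q) s T Q"
proof (cases "bval b s")
  case True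
  with assms(2) obtain t s' where "exec p s t s'" "t \<le> T - (bcost b + 1)" "Q s'"
    unfolding runs_def by blast
  with exec_IfTrue[OF True, of p t s' q] assms(1) show ?thesis
    unfolding runs_def by (intro exI[of _ "bcost b + 1 + t"] exI[of _ s']) auto
next
  case False
  with assms(3) obtain t s' where "exec q s t s'" "t \<le> T - (bcost b + 1)" "Q s'"
    unfolding runs_def by blast
  with exec_IfFalse[OF False, of q t s' p] assms(1) show ?thesis
    unfolding runs_def by (intro exI[of _ "bcost b + 1 + t"] exI[of _ s']) auto
qed

text \<open>Induction on the bound \<open>N\<close> for the variant \<open>f\<close>: each round
  pays one successful test and at most \<open>B\<close>, and one failing test is paid at the
  end.\<close>

lemma runs_While:
  fixes f :: "state \<Rightarrow> nat"
  assumes step: "\<And>t. I t \<Longrightarrow> bval b t \<Longrightarrow> runs p t B (\<lambda>t'. I t' \<and> f t' < f t)"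
    and "I s" "f s \<le> N"
  shows "runs (While b p) s (bcost b + 1 + N * (bcost b + 1 + B)) (\<lambda>t. I t \<and> \<not> bval b t)"
  using assms(2,3)
proof (induction N arbitrary: s)
  case 0
  \<comment> \<open>Another round would have to push the variant below 0.\<close>
  then have "\<not> bval b s"
    using step[of s] unfolding runs_def by auto
  then show ?case
    unfolding runs_deterministic_step[OF exec_WhileFalse[OF \<open>\<not> bval b s\<close>]] using 0 by simp
next
  case (Suc N)
  show ?case
  proof (cases "bval b s")
    case True
    with step[of s] Suc.prems obtain t s' where
      1: "exec p s t s'" "t \<le> B" "I s'" "f s' < f s"
      unfolding runs_def by blast
    with Suc.IH[of s'] Suc.prems obtain u s'' where
      2: "exec (While b p) s' u s''" "u \<le> bcost b + 1 + N * (bcost b + 1 + B)"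
        "I s''" "\<not> bval b s''"
      unfolding runs_def by auto
    from exec_WhileTrue[OF True 1(1) 2(1)] 1(2) 2(2,3,4) show ?thesis
      unfolding runs_def
      by (intro exI[of _ "bcost b + 1 + t + u"] exI[of _ s'']) auto
  next
    case False
    then show ?thesis
      unfolding runs_deterministic_step[OF exec_WhileFalse[OF False]] using Suc.prems by simp
  qed
qed

definition for_loop :: "vname \<Rightarrow> vname \<Rightarrow> com \<Rightarrow> com" where
  "for_loop i n p =
     Seq (Assign i (Const 0))
       (While (Less (Reg i) (Reg n)) (Seq p (Assign i (Add (Reg i) (Const 1)))))"

text \<open>The invariant counts completed rounds and is restored only after the counter has been
  advanced. Per round, 8 pays for the test (4) and the increment (4); the 6 pays for the initial
  assignment (2) and the last test (4).\<close>

lemma runs_for_loop: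
  assumes "reg s n = N" "i \<noteq> n" "I 0 (s\<lparr>reg := (reg s)(i := 0)\<rparr>)"
    and step: "\<And>k t. \<lbrakk>k < N; I k t; reg t i = k; reg t n = N\<rbrakk> \<Longrightarrow>
      runs p t B (\<lambda>t'. reg t' i = k \<and> reg t' n = N \<and>
                       I (Suc k) (t'\<lparr>reg := (reg t')(i := Suc k)\<rparr>))"
  shows "runs (for_loop i n p) s (6 + N * (B + 8)) (I N)"
proof -
  let ?b = "Less (Reg i) (Reg n)"
  let ?p = "Seq p (Assign i (Add (Reg i) (Const 1)))"
  let ?J = "\<lambda>t. reg t n = N \<and> reg t i \<le> N \<and> I (reg t i) t"
  have "runs (While ?b ?p) (s\<lparr>reg := (reg s)(i := 0)\<rparr>)
    (bcost ?b + 1 + N * (bcost ?b + 1 + (B + 4))) (\<lambda>t. ?J t \<and> \<not> bval ?b t)"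
  proof (rule runs_While[where f = "\<lambda>t. N - reg t i"])
    fix t assume J: "?J t" and b: "bval ?b t"
    then have "reg t i < N" by simp
    with J have "runs p t B (\<lambda>t'. reg t' i = reg t i \<and> reg t' n = N \<and>
        I (Suc (reg t i)) (t'\<lparr>reg := (reg t')(i := Suc (reg t i))\<rparr>))"
      by (intro step) auto
    then show "runs ?p t (B + 4) (\<lambda>t'. ?J t' \<and> N - reg t' i < N - reg t i)"
      by (rule runs_Seq[where ?T2.0 = 4]) (use assms(2) \<open>reg t i < N\<close> in auto)
  qed (use assms in auto)
  then have "runs (While ?b ?p) (s\<lparr>reg := (reg s)(i := 0)\<rparr>) (4 + N * (B + 8)) (I N)"
    by (rule runs_mono) (auto simp: algebra_simps)
  then show ?thesis
    unfolding for_loop_def by (intro runs_Seq_Assign) simp_all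
qed

text \<open>The frame condition for subprograms. It fixes all real registers because the only one
  ever assigned, \<open>cap\<close>, is set between the subprograms it describes.\<close>

definition agree_except :: "vname set \<Rightarrow> vname set \<Rightarrow> state \<Rightarrow> state \<Rightarrow> bool" where
  "agree_except R A s t \<longleftrightarrow>
     (\<forall>x. x \<notin> R \<longrightarrow> reg t x = reg s x) \<and> (\<forall>a. a \<notin> A \<longrightarrow> arr t a = arr s a) \<and>
     rreg t = rreg s"


section \<open>Working copies of the given sets and their membership bits\<close>

section \<open>Loading the input sets\<close>

text \<open>Membership bits are only maintained for endpoints of edges, since clearing all \<open>n\<close> bits would
  not be linear in \<open>m\<close>.\<close>

definition marks :: "(nat \<Rightarrow> nat) \<Rightarrow> (nat \<Rightarrow> nat) \<Rightarrow> nat \<Rightarrow> nat set \<Rightarrow> bool" where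
  "marks x f m A \<longleftrightarrow> (\<forall>i<m. x (f i) = 0 \<longleftrightarrow> f i \<notin> A)"

text \<open>\<open>T\<close> is a working copy that later grows in place, while the input list
  \<open>S\<close> stays intact.\<close>

definition load_set :: "vname \<Rightarrow> vname \<Rightarrow> vname \<Rightarrow> vname \<Rightarrow> com" where
  "load_set u X S T =
     Seq (for_loop ''i'' ''m'' (Store X (Arr u (Reg ''i'')) (Const 0)))
    (Seq (for_loop ''i'' S
           (Seq (Store X (Arr S (Reg ''i'')) (Const 1))
                (Store T (Reg ''i'') (Arr S (Reg ''i'')))))
         (Assign T (Reg S)))"

text \<open>The cost depends on the length \<open>l\<close> of the list as well as on
  \<open>m\<close>, so linear time in \<open>m\<close> requires that only sets of size O(m) be
  loaded.\<close>

lemma runs_load_set: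
  assumes "stores_set s S A" "reg s ''m'' = m" "reg s S = l"
    and "distinct [u, X, S, T]" "S \<noteq> ''i''" "T \<noteq> ''i''"
  shows "runs (load_set u X S T) s (30 + 20 * m + 20 * l)
    (\<lambda>t. agree_except {''i'', T} {X, T} s t \<and> stores_set t T A \<and> marks (arr t X) (arr s u) m A)"
proof -
  let ?I = "\<lambda>k t. agree_except {''i''} {X} s t \<and> (\<forall>i<k. arr t X (arr s u i) = 0)"
  have 1: "runs (for_loop ''i'' ''m'' (Store X (Arr u (Reg ''i'')) (Const 0))) s
      (6 + m * (5 + 8)) (?I m)"
    by (rule runs_for_loop[where I = ?I]) (use assms in \<open>auto simp: agree_except_def less_Suc_eq\<close>)
  let ?J = "\<lambda>k t. agree_except {''i''} {X, T} s t \<and> (\<forall>i<k. arr t T i = arr s S i) \<and>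
      (\<forall>i<m. arr t X (arr s u i) = 0 \<longleftrightarrow> arr s u i \<notin> arr s S ` {..<k})"
  have 2: "runs (for_loop ''i'' S
           (Seq (Store X (Arr S (Reg ''i'')) (Const 1))
                (Store T (Reg ''i'') (Arr S (Reg ''i''))))) t
      (6 + l * (10 + 8)) (?J l)" if "?I m t" for t
    by (rule runs_for_loop[where I = ?J])
      (use that assms in \<open>auto simp: agree_except_def less_Suc_eq lessThan_Suc image_iff\<close>)
  have A: "arr s S ` {..<l} = A"
    using assms(1,3) by (simp add: stores_set_def bij_betw_def)
  have 3: "runs (Assign T (Reg S)) t 2
      (\<lambda>t. agree_except {''i'', T} {X, T} s t \<and> stores_set t T A \<and> marks (arr t X) (arr s u) m A)"
    if "?J l t" for t
  proof -
    from that have "reg t S = l" "\<And>i. i < l \<Longrightarrow> arr t T i = arr s S i"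
      using assms by (auto simp: agree_except_def)
    moreover have "bij_betw (arr t T) {..<l} A"
      using assms(1,3) calculation(2) bij_betw_cong[of "{..<l}" "arr t T" "arr s S" A]
      by (auto simp: stores_set_def)
    ultimately show ?thesis
      using that assms by (auto simp: agree_except_def stores_set_def marks_def A)
  qed
  show ?thesis
    unfolding load_set_def
    by (rule runs_Seq[OF 1 runs_Seq[OF 2 3 order_refl]]) (auto simp: algebra_simps)
qed


section \<open>Degrees, edge counts and optimality of greedy selection\<close>

section \<open>Selecting vertices of largest degree\<close>

text \<open>Edges are indices \<open>i < m\<close> with endpoint arrays \<open>U\<close> and
  \<open>W\<close> in either order, so that one development covers out-degrees into \<open>B\<close>
  and in-degrees from \<open>B\<close>.\<close>

definition degree_into :: "nat \<Rightarrow> (nat \<Rightarrow> nat) \<Rightarrow> (nat \<Rightarrow> nat) \<Rightarrow> nat set \<Rightarrow> nat \<Rightarrow> nat" where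
  "degree_into m U W B v = card {i. i < m \<and> U i = v \<and> W i \<in> B}"

definition edge_count :: "nat \<Rightarrow> (nat \<Rightarrow> nat) \<Rightarrow> (nat \<Rightarrow> nat) \<Rightarrow> nat set \<Rightarrow> nat set \<Rightarrow> nat" where
  "edge_count m U W A B = card {i. i < m \<and> U i \<in> A \<and> W i \<in> B}"

text \<open>Each edge is charged to its \<open>U\<close> endpoint. Maximizing the edges into
  \<open>B\<close> thus becomes choosing vertices of largest degree.\<close>

lemma edge_count_eq_sum:
  assumes "finite A"
  shows "edge_count m U W A B = (\<Sum>v\<in>A. degree_into m U W B v)"
proof -
  have "{i. i < m \<and> U i \<in> A \<and> W i \<in> B} = (\<Union>v\<in>A. {i. i < m \<and> U i = v \<and> W i \<in> B})"
    by auto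
  then show ?thesis
    unfolding edge_count_def degree_into_def
    by (simp only:, subst card_UN_disjoint) (use assms in auto)
qed

lemma edge_count_swap: "edge_count m U W A B = edge_count m W U B A"
  unfolding edge_count_def by (rule arg_cong[of _ _ card]) auto

lemma degree_into_Suc:
  "degree_into (Suc k) U W B v =
     degree_into k U W B v + (if U k = v \<and> W k \<in> B then 1 else 0)"
proof -
  have "{i. i < Suc k \<and> U i = v \<and> W i \<in> B} =
      {i. i < k \<and> U i = v \<and> W i \<in> B} \<union> (if U k = v \<and> W k \<in> B then {k} else {})"
    by (auto simp: less_Suc_eq)
  then show ?thesis
    unfolding degree_into_def by auto
qed

lemma degree_into_le: "degree_into k U W B v \<le> k"
  unfolding degree_into_def by (rule order_trans[OF card_mono[of "{..<k}"]]) auto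

lemma degree_into_eq_0: "v \<notin> U ` {..<m} \<Longrightarrow> degree_into m U W B v = 0"
  unfolding degree_into_def by (auto simp: card_eq_0_iff)

text \<open>Exchange argument: passing from \<open>R\<close> to \<open>Z\<close> gives up elements
  of weight at most \<open>\<theta>\<close> and gains at least as many of weight at least
  \<open>\<theta>\<close>.\<close>

lemma sum_le_by_threshold:
  fixes d :: "'a \<Rightarrow> nat"
  assumes "finite R" "finite Z" "card R \<le> card Z"
    and "\<And>v. v \<in> R - Z \<Longrightarrow> d v \<le> \<theta>" "\<And>v. v \<in> Z - R \<Longrightarrow> \<theta> \<le> d v"
  shows "sum d R \<le> sum d Z"
proof -
  have card: "card (R - Z) \<le> card (Z - R)"
  proof -
    have "card R = card (R - Z) + card (R \<inter> Z)" "card Z = card (Z - R) + card (R \<inter> Z)"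
      using assms(1,2) by (metis card_Int_Diff add.commute, metis card_Int_Diff Int_commute add.commute)
    with assms(3) show ?thesis by simp
  qed
  have "sum d (R - Z) \<le> card (R - Z) * \<theta>"
    using sum_bounded_above[of "R - Z" d \<theta>] assms(4) by simp
  also have "\<dots> \<le> card (Z - R) * \<theta>"
    using card by simp
  also have "\<dots> \<le> sum d (Z - R)"
    using sum_bounded_below[of "Z - R" \<theta> d] assms(5) by simp
  finally have "sum d (R - Z) + sum d (R \<inter> Z) \<le> sum d (Z - R) + sum d (Z \<inter> R)"
    by (simp add: Int_commute)
  then show ?thesis
    using assms(1,2) by (simp add: sum.Int_Diff[of R d Z] sum.Int_Diff[of Z d R] add.commute)
qed

text \<open>The two-pass selection: \<open>\<tau>\<close> is the least threshold whose vertices all fit, so taking these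
  and then filling up with vertices of degree \<open>\<tau> - 1\<close> yields the best set within the capacity.\<close>

lemma two_pass_optimal:
  fixes d :: "nat \<Rightarrow> nat" and cap :: real
  assumes fin: "finite S" "finite K"
    and d0: "\<And>v. v \<notin> K \<Longrightarrow> d v = 0"
    and \<tau>: "1 \<le> \<tau>" "real (card {v \<in> K - S. \<tau> \<le> d v} + card S) \<le> cap"
      "1 < \<tau> \<Longrightarrow> cap < real (card {v \<in> K - S. \<tau> - 1 \<le> d v} + card S)"
    and Z1: "S \<subseteq> Z1" "Z1 \<subseteq> S \<union> K" "\<And>v. v \<in> Z1 - S \<Longrightarrow> \<tau> \<le> d v"
      "\<And>v. v \<in> K - Z1 \<Longrightarrow> d v < \<tau> \<or> cap < real (card Z1) + 1"
    and Z2: "Z1 \<subseteq> Z2" "Z2 \<subseteq> Z1 \<union> K" "\<And>v. v \<in> Z2 - Z1 \<Longrightarrow> \<tau> - 1 \<le> d v"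
      "\<And>v. v \<in> K - Z2 \<Longrightarrow> d v < \<tau> - 1 \<or> cap < real (card Z2) + 1" "real (card Z2) \<le> cap"
    and R: "finite R" "S \<subseteq> R" "real (card R) \<le> cap"
  shows "sum d R \<le> sum d Z2"
proof -
  have finZ: "finite Z1" "finite Z2"
    using fin Z1(2) Z2(2) by (auto intro: finite_subset)
  \<comment> \<open>The first pass takes every vertex of degree at least \<open>\<tau>\<close>: one
    left out would have been refused for lack of room, yet it fits together with \<open>Z1\<close>
    inside a set that respects the capacity.\<close>
  have small: "d v < \<tau>" if "v \<notin> Z1" for v
  proof (rule ccontr)
    assume high: "\<not> d v < \<tau>"
    then have K: "v \<in> K" using d0[of v] \<tau>(1) by auto
    with Z1(4)[of v] high that have "cap < real (card Z1) + 1" by auto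
    moreover have "card (insert v Z1) \<le> card ({v \<in> K - S. \<tau> \<le> d v} \<union> S)"
      by (rule card_mono) (use fin Z1 K high that in \<open>auto simp: not_less\<close>)
    then have "card Z1 + 1 \<le> card {v \<in> K - S. \<tau> \<le> d v} + card S"
      using card_Un_le[of "{v \<in> K - S. \<tau> \<le> d v}" S] that finZ by simp
    ultimately show False using \<tau>(2) by linarith
  qed
  show ?thesis
  proof (cases "cap < real (card Z2) + 1")
    \<comment> \<open>No further vertex fits, so no admissible \<open>R\<close> is larger than
      \<open>Z2\<close>, and \<open>\<tau> - 1\<close> separates the degrees outside
      \<open>Z2\<close> from those in \<open>Z2 - R\<close>.\<close>
    case True
    show ?thesis
    proof (rule sum_le_by_threshold[where \<theta> = "\<tau> - 1"])
      show "card R \<le> card Z2" using True R(3) by linarith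
      show "d v \<le> \<tau> - 1" if "v \<in> R - Z2" for v
      proof -
        from that Z2(1) have "d v < \<tau>" by (intro small) auto
        then show ?thesis by simp
      qed
      show "\<tau> - 1 \<le> d v" if "v \<in> Z2 - R" for v
        using Z1(3)[of v] Z2(3)[of v] R(2) that by fastforce
    qed (use R finZ in auto)
  next
    case False
    \<comment> \<open>With room to spare, the second pass refused no vertex of degree at least
      \<open>\<tau> - 1\<close>. So all of them fit, against the minimality of \<open>\<tau>\<close>
      if \<open>\<tau>\<close> exceeds 1. For \<open>\<tau> = 1\<close> this means that
      \<open>Z2\<close> contains all of \<open>K\<close>.\<close>
    have "\<not> 1 < \<tau>"
    proof
      assume "1 < \<tau>"
      have "card ({v \<in> K - S. \<tau> - 1 \<le> d v} \<union> S) \<le> card Z2"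
      proof (rule card_mono[OF finZ(2)])
        show "{v \<in> K - S. \<tau> - 1 \<le> d v} \<union> S \<subseteq> Z2"
          using Z2(1,4) Z1(1) False by force
      qed
      moreover have "card ({v \<in> K - S. \<tau> - 1 \<le> d v} \<union> S) =
          card {v \<in> K - S. \<tau> - 1 \<le> d v} + card S"
        by (rule card_Un_disjoint) (use fin in auto)
      ultimately show False using \<tau>(3)[OF \<open>1 < \<tau>\<close>] Z2(5) by linarith
    qed
    with Z2(4) False have "d v = 0" if "v \<notin> Z2" for v
      using d0[of v] that by fastforce
    then have "sum d R = sum d (R \<inter> Z2)"
      by (intro sum.mono_neutral_right) (use R in auto)
    also have "\<dots> \<le> sum d Z2"
      by (rule sum_mono2) (use finZ in auto)
    finally show ?thesis .
  qed
qed


section \<open>Greedy extension of one side in time linear in the number of edges\<close>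

section \<open>Extending one side\<close>

text \<open>Counters are cumulative: \<open>C\<close> at \<open>j\<close> counts the vertices of
  degree at least \<open>j\<close>, not exactly \<open>j\<close>. The separate store clears entry
  \<open>m + 1\<close>, which stays 0 and stops the later threshold search.\<close>

definition count_degrees :: "vname \<Rightarrow> vname \<Rightarrow> vname \<Rightarrow> vname \<Rightarrow> com" where
  "count_degrees u w X Y =
     Seq (for_loop ''i'' ''m''
           (Seq (Store ''D'' (Arr u (Reg ''i'')) (Const 0))
                (Store ''C'' (Add (Reg ''i'') (Const 1)) (Const 0))))
    (Seq (Store ''C'' (Add (Reg ''m'') (Const 1)) (Const 0))
         (for_loop ''i'' ''m''
           (If (Conj (Less (Arr X (Arr u (Reg ''i''))) (Const 1))
                     (Neg (Less (Arr Y (Arr w (Reg ''i''))) (Const 1))))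
             (Seq (Store ''D'' (Arr u (Reg ''i'')) (Add (Arr ''D'' (Arr u (Reg ''i''))) (Const 1)))
                  (Store ''C'' (Arr ''D'' (Arr u (Reg ''i'')))
                     (Add (Arr ''C'' (Arr ''D'' (Arr u (Reg ''i'')))) (Const 1))))
             Skip)))"

text \<open>Raising a degree by one moves \<open>v\<close> into exactly one new threshold set, so a
  single counter increment per edge suffices.\<close>

lemma card_threshold_update:
  fixes d :: "'a \<Rightarrow> nat"
  assumes "finite K" "v \<in> K"
  shows "card {x \<in> K. j \<le> (d(v := Suc (d v))) x} =
    card {x \<in> K. j \<le> d x} + (if j = Suc (d v) then 1 else 0)"
proof (cases "j = Suc (d v)")
  case True
  then have "{x \<in> K. j \<le> (d(v := Suc (d v))) x} = insert v {x \<in> K. j \<le> d x}"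
    using assms by auto
  then show ?thesis using True assms by simp
next
  case False
  then have "{x \<in> K. j \<le> (d(v := Suc (d v))) x} = {x \<in> K. j \<le> d x}"
    using assms by auto
  then show ?thesis using False by simp
qed

lemma runs_count_degrees:
  assumes "reg s ''m'' = m" "marks (arr s X) (arr s u) m A" "marks (arr s Y) (arr s w) m B"
    and "distinct [u, w, X, Y, ''D'', ''C'']"
  shows "runs (count_degrees u w X Y) s (30 + 60 * m)
    (\<lambda>t. agree_except {''i''} {''D'', ''C''} s t \<and>
         (\<forall>v \<in> arr s u ` {..<m} - A. arr t ''D'' v = degree_into m (arr s u) (arr s w) B v) \<and>
         (\<forall>j \<in> {1..Suc m}. arr t ''C'' j =
            card {v \<in> arr s u ` {..<m} - A. j \<le> degree_into m (arr s u) (arr s w) B v}))"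
proof -
  define U W where "U = arr s u" and "W = arr s w"
  define K where "K = U ` {..<m} - A"
  let ?d = "\<lambda>k. degree_into k U W B"
  let ?F = "agree_except {''i''} {''D'', ''C''} s"
  let ?I = "\<lambda>k t. ?F t \<and> (\<forall>i<k. arr t ''D'' (U i) = 0 \<and> arr t ''C'' (Suc i) = 0)"
  let ?clear = "Seq (Store ''D'' (Arr u (Reg ''i'')) (Const 0))
                (Store ''C'' (Add (Reg ''i'') (Const 1)) (Const 0))"
  let ?count = "If (Conj (Less (Arr X (Arr u (Reg ''i''))) (Const 1))
                     (Neg (Less (Arr Y (Arr w (Reg ''i''))) (Const 1))))
             (Seq (Store ''D'' (Arr u (Reg ''i'')) (Add (Arr ''D'' (Arr u (Reg ''i''))) (Const 1)))
                  (Store ''C'' (Arr ''D'' (Arr u (Reg ''i'')))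
                     (Add (Arr ''C'' (Arr ''D'' (Arr u (Reg ''i'')))) (Const 1))))
             Skip"
  have 1: "runs (for_loop ''i'' ''m'' ?clear) s (6 + m * (10 + 8)) (?I m)"
    by (rule runs_for_loop[where I = ?I]) (use assms in \<open>auto simp: agree_except_def less_Suc_eq U_def\<close>)
  let ?J = "\<lambda>k t. ?F t \<and> (\<forall>v\<in>K. arr t ''D'' v = ?d k v) \<and>
      (\<forall>j \<in> {1..Suc m}. arr t ''C'' j = card {v \<in> K. j \<le> ?d k v})"
  have 2: "runs (Store ''C'' (Add (Reg ''m'') (Const 1)) (Const 0)) t 5 (?J 0)"
    if "?I m t" for t
  proof -
    have [simp]: "?d 0 v = 0" for v by (simp add: degree_into_def)
    have "arr t ''D'' v = 0" if "v \<in> K" for v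
      using that \<open>?I m t\<close> by (auto simp: K_def)
    moreover have "arr t ''C'' j = 0" if "1 \<le> j" "j \<le> m" for j
      using that \<open>?I m t\<close> by (cases j) auto
    moreover have "reg t ''m'' = m"
      using that assms by (simp add: agree_except_def)
    ultimately show ?thesis
      using that by (auto simp: agree_except_def le_Suc_eq)
  qed
  have 3: "runs (for_loop ''i'' ''m'' ?count) t (6 + m * (34 + 8)) (?J m)" if "?J 0 t" for t
  proof (rule runs_for_loop[where I = ?J])
    show "reg t ''m'' = m" using that assms by (simp add: agree_except_def)
    show "?J 0 (t\<lparr>reg := (reg t)(''i'' := 0)\<rparr>)" using that by (simp add: agree_except_def)
    fix k t' assume k: "k < m" and J: "?J k t'" and r: "reg t' ''i'' = k" "reg t' ''m'' = m"
    have a: "arr t' u = U" "arr t' w = W" "arr t' X = arr s X" "arr t' Y = arr s Y"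
      using J assms(4) by (auto simp: agree_except_def U_def W_def)
    have mX: "arr s X (U k) = 0 \<longleftrightarrow> U k \<notin> A" and mY: "arr s Y (W k) = 0 \<longleftrightarrow> W k \<notin> B"
      using assms(2,3) k by (auto simp: marks_def U_def W_def)
    have F: "agree_except {''i''} {''D'', ''C''} s t'" using J by simp
    show "runs ?count t' 34 (\<lambda>t''. reg t'' ''i'' = k \<and> reg t'' ''m'' = m \<and>
        ?J (Suc k) (t''\<lparr>reg := (reg t'')(''i'' := Suc k)\<rparr>))"
    proof (cases "U k \<notin> A \<and> W k \<in> B")
      case True
      then have K: "U k \<in> K" using k by (auto simp: K_def)
      have D: "arr t' ''D'' v = ?d k v" if "v \<in> K" for v using J that by blast
      have C: "arr t' ''C'' j = card {v \<in> K. j \<le> ?d k v}" if "1 \<le> j" "j \<le> Suc m" for j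
        using J that by simp
      have d: "?d (Suc k) = (?d k)(U k := Suc (?d k (U k)))"
        using True by (auto simp: degree_into_Suc)
      have le: "?d k (U k) \<le> m" using degree_into_le[of k U W B "U k"] k by simp
      have fin: "finite K" by (simp add: K_def)
      have b: "bval (Conj (Less (Arr X (Arr u (Reg ''i''))) (Const 1))
                     (Neg (Less (Arr Y (Arr w (Reg ''i''))) (Const 1)))) t'"
        using True mX mY by (simp add: a r)
      \<comment> \<open>The second store reads \<open>D\<close> after the first has updated it, so
        the counter that grows is the one of the new degree.\<close>
      define t'' where "t'' = t'\<lparr>arr := (arr t')(''D'' := (arr t' ''D'')(U k := Suc (?d k (U k))),
        ''C'' := (arr t' ''C'')(Suc (?d k (U k)) := Suc (arr t' ''C'' (Suc (?d k (U k))))))\<rparr>"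
      have J': "?J (Suc k) (t''\<lparr>reg := (reg t'')(''i'' := Suc k)\<rparr>)"
        unfolding d card_threshold_update[OF fin K]
        using F by (auto simp: t''_def agree_except_def D C le K)
      have "u \<noteq> ''D''" "u \<noteq> ''C''" using assms(4) by auto
      then have "runs ?count t' 34 (\<lambda>x. x = t'')"
        using b by (intro runs_If runs_Seq_Store) (auto simp: t''_def a r D K)
      then show ?thesis
        by (rule runs_mono) (use J' r in \<open>auto simp: t''_def\<close>)
    next
      case False
      \<comment> \<open>An edge with \<open>U k\<close> in \<open>A\<close> may raise the degree of
        that endpoint, but \<open>K\<close> excludes \<open>A\<close>, so the invariant does not see
        the change.\<close>
      then have d: "?d (Suc k) v = ?d k v" if "v \<in> K" for v
        using that by (auto simp: degree_into_Suc K_def)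
      then have "{v \<in> K. j \<le> ?d (Suc k) v} = {v \<in> K. j \<le> ?d k v}" for j by auto
      then have J': "?J (Suc k) (t'\<lparr>reg := (reg t')(''i'' := Suc k)\<rparr>)"
        using J d by (simp add: agree_except_def)
      show ?thesis
        by (rule runs_If) (use False mX mY J' in \<open>auto simp: a r\<close>)
    qed
  qed simp
  have "runs (count_degrees u w X Y) s (30 + 60 * m) (?J m)"
    unfolding count_degrees_def
    by (rule runs_Seq[OF 1 runs_Seq[OF 2 3 order_refl]]) (auto simp: algebra_simps)
  then show ?thesis
    unfolding K_def U_def W_def .
qed

text \<open>The caller stores the capacity \<open>card S / (1 - \<epsilon>)\<close> of the extended set in \<open>cap\<close>.\<close>

definition find_threshold :: "vname \<Rightarrow> com" where
  "find_threshold T =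
     Seq (Assign ''j'' (Const 1))
       (While (RLess (RReg ''cap'') (RNat (Add (Arr ''C'' (Reg ''j'')) (Reg T))))
         (Assign ''j'' (Add (Reg ''j'') (Const 1))))"

text \<open>At \<open>m + 1\<close> the counter is 0 and the test fails, since the present set fits;
  hence at most \<open>m\<close> rounds. The last successful test supplies the strict inequality at
  the predecessor.\<close>

lemma runs_find_threshold:
  assumes "arr s ''C'' (Suc m) = 0" "real (reg s T) \<le> rreg s ''cap''" "T \<noteq> ''j''"
  shows "runs (find_threshold T) s (20 + 20 * m)
    (\<lambda>t. agree_except {''j''} {} s t \<and> reg t ''j'' \<in> {1..Suc m} \<and>
         real (arr s ''C'' (reg t ''j'') + reg s T) \<le> rreg s ''cap'' \<and>
         (1 < reg t ''j'' \<longrightarrow> rreg s ''cap'' < real (arr s ''C'' (reg t ''j'' - 1) + reg s T)))"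
proof -
  let ?s = "s\<lparr>reg := (reg s)(''j'' := 1)\<rparr>"
  let ?I = "\<lambda>t. agree_except {''j''} {} s t \<and> reg t ''j'' \<in> {1..Suc m} \<and>
      (1 < reg t ''j'' \<longrightarrow> rreg s ''cap'' < real (arr s ''C'' (reg t ''j'' - 1) + reg s T))"
  let ?b = "RLess (RReg ''cap'') (RNat (Add (Arr ''C'' (Reg ''j'')) (Reg T)))"
  have "runs (While ?b (Assign ''j'' (Add (Reg ''j'') (Const 1)))) ?s
      (bcost ?b + 1 + m * (bcost ?b + 1 + 4)) (\<lambda>t. ?I t \<and> \<not> bval ?b t)"
  proof (rule runs_While[where f = "\<lambda>t. Suc m - reg t ''j''"])
    fix t assume I: "?I t" and b: "bval ?b t"
    have "reg t ''j'' \<noteq> Suc m"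
      using I b assms by (auto simp: agree_except_def)
    with I b assms show "runs (Assign ''j'' (Add (Reg ''j'') (Const 1))) t 4
        (\<lambda>t'. ?I t' \<and> Suc m - reg t' ''j'' < Suc m - reg t ''j'')"
      by (auto simp: agree_except_def)
  qed (auto simp: agree_except_def)
  then show ?thesis
    unfolding find_threshold_def
    by (intro runs_Seq_Assign) (auto elim!: runs_mono simp: agree_except_def assms not_less)
qed

text \<open>The scan runs over edges rather than vertices. Marking a vertex on insertion prevents a
  repeated endpoint from being listed twice.\<close>

definition add_above :: "vname \<Rightarrow> vname \<Rightarrow> vname \<Rightarrow> com" where
  "add_above u X T =
     for_loop ''i'' ''m''
       (If (Conj (Less (Arr X (Arr u (Reg ''i''))) (Const 1))
           (Conj (Neg (Less (Arr ''D'' (Arr u (Reg ''i''))) (Reg ''j'')))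
                 (Neg (RLess (RReg ''cap'') (RNat (Add (Reg T) (Const 1)))))))
         (Seq (Store X (Arr u (Reg ''i'')) (Const 1))
         (Seq (Store T (Reg T) (Arr u (Reg ''i'')))
              (Assign T (Add (Reg T) (Const 1)))))
         Skip)"

lemma stores_set_card: "stores_set s T A \<Longrightarrow> finite A \<and> card A = reg s T"
  unfolding stores_set_def using bij_betw_finite bij_betw_same_card by fastforce

lemma bij_betw_append:
  assumes "bij_betw f {..<l} A" "v \<notin> A"
  shows "bij_betw (f(l := v)) {..<Suc l} (insert v A)"
proof -
  have "bij_betw (f(l := v)) {..<l} A"
    using assms(1) by (subst bij_betw_cong[where g = f]) auto
  then show ?thesis
    using notIn_Un_bij_betw[of l "{..<l}" "f(l := v)" A] assms(2) by (simp add: lessThan_Suc)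
qed

text \<open>Once one more vertex does not fit, nothing is inserted any longer. Hence the reason for
  refusing a vertex still holds for the final set.\<close>

lemma runs_add_above:
  assumes "reg s ''m'' = m" "stores_set s T A" "marks (arr s X) (arr s u) m A"
    and "reg s ''j'' = \<theta>" "rreg s ''cap'' = cap" "real (card A) \<le> cap"
    and "distinct [u, X, T, ''D'']" "T \<noteq> ''i''" "T \<noteq> ''j''" "T \<noteq> ''m''"
  shows "runs (add_above u X T) s (10 + 60 * m)
    (\<lambda>t. agree_except {''i'', T} {X, T} s t \<and>
         (\<exists>Z. stores_set t T Z \<and> marks (arr t X) (arr s u) m Z \<and>
              A \<subseteq> Z \<and> Z \<subseteq> A \<union> (arr s u ` {..<m} - A) \<and> real (card Z) \<le> cap \<and>
              (\<forall>v\<in>Z - A. \<theta> \<le> arr s ''D'' v) \<and>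
              (\<forall>v\<in>arr s u ` {..<m} - Z. arr s ''D'' v < \<theta> \<or> cap < real (card Z) + 1)))"
proof -
  define U where "U = arr s u"
  define d where "d = arr s ''D''"
  let ?Z = "\<lambda>k t Z. stores_set t T Z \<and> marks (arr t X) U m Z \<and>
      A \<subseteq> Z \<and> Z \<subseteq> A \<union> U ` {..<m} \<and> real (card Z) \<le> cap \<and>
      (\<forall>v\<in>Z - A. \<theta> \<le> d v) \<and>
      (\<forall>v\<in>U ` {..<k} - Z. d v < \<theta> \<or> cap < real (card Z) + 1)"
  let ?I = "\<lambda>k t. agree_except {''i'', T} {X, T} s t \<and> (\<exists>Z. ?Z k t Z)"
  let ?b = "Conj (Less (Arr X (Arr u (Reg ''i''))) (Const 1))
           (Conj (Neg (Less (Arr ''D'' (Arr u (Reg ''i''))) (Reg ''j'')))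
                 (Neg (RLess (RReg ''cap'') (RNat (Add (Reg T) (Const 1))))))"
  let ?p = "Seq (Store X (Arr u (Reg ''i'')) (Const 1))
         (Seq (Store T (Reg T) (Arr u (Reg ''i'')))
              (Assign T (Add (Reg T) (Const 1))))"
  have "runs (add_above u X T) s (6 + m * (45 + 8)) (?I m)"
    unfolding add_above_def
  proof (rule runs_for_loop[where I = ?I])
    show "?I 0 (s\<lparr>reg := (reg s)(''i'' := 0)\<rparr>)"
      using assms by (auto simp: agree_except_def stores_set_def U_def)
    fix k t assume k: "k < m" and I: "?I k t" and r: "reg t ''i'' = k" "reg t ''m'' = m"
    then obtain Z where F: "agree_except {''i'', T} {X, T} s t" and Z: "?Z k t Z" by blast
    have a: "arr t u = U" "arr t ''D'' = d" "reg t ''j'' = \<theta>" "rreg t ''cap'' = cap"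
      using F assms by (auto simp: agree_except_def U_def d_def)
    have len: "reg t T = card Z" and fin: "finite Z"
      using Z stores_set_card by metis+
    have b: "bval ?b t \<longleftrightarrow> U k \<notin> Z \<and> \<theta> \<le> d (U k) \<and> real (card Z) + 1 \<le> cap"
      using Z k by (auto simp: a r len marks_def not_less)
    show "runs (If ?b ?p Skip) t 45 (\<lambda>t'. reg t' ''i'' = k \<and> reg t' ''m'' = m \<and>
        ?I (Suc k) (t'\<lparr>reg := (reg t')(''i'' := Suc k)\<rparr>))"
    proof (cases "bval ?b t")
      case True
      define t' where "t' = t\<lparr>arr := (arr t)(X := (arr t X)(U k := 1),
          T := (arr t T)(card Z := U k)), reg := (reg t)(T := Suc (card Z))\<rparr>"
      have nX: "X \<noteq> T" "T \<noteq> X" "u \<noteq> X" "u \<noteq> T" using assms by auto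
      have "runs (If ?b ?p Skip) t 45 (\<lambda>x. x = t')"
        using True by (intro runs_If runs_Seq_Store) (auto simp: t'_def a r len nX)
      moreover have "?Z (Suc k) (t'\<lparr>reg := (reg t')(''i'' := Suc k)\<rparr>) (insert (U k) Z)"
        using Z True[unfolded b] k fin bij_betw_append[of "arr t T" "card Z" Z "U k"] nX assms(8)
        by (auto simp: t'_def stores_set_def marks_def lessThan_Suc len)
      moreover have "agree_except {''i'', T} {X, T} s (t'\<lparr>reg := (reg t')(''i'' := Suc k)\<rparr>)"
        using F by (auto simp: t'_def agree_except_def)
      moreover have "reg t' ''i'' = k" "reg t' ''m'' = m"
        using r assms by (auto simp: t'_def)
      ultimately show ?thesis
        by (elim runs_mono) blast+
    next
      case False
      then have "?Z (Suc k) (t\<lparr>reg := (reg t)(''i'' := Suc k)\<rparr>) Z"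
        using Z b assms(8) by (auto simp: stores_set_def lessThan_Suc)
      moreover have "agree_except {''i'', T} {X, T} s (t\<lparr>reg := (reg t)(''i'' := Suc k)\<rparr>)"
        using F by (auto simp: agree_except_def)
      ultimately have "runs Skip t 1 (\<lambda>t'. reg t' ''i'' = k \<and> reg t' ''m'' = m \<and>
          ?I (Suc k) (t'\<lparr>reg := (reg t')(''i'' := Suc k)\<rparr>))"
        using r by (simp del: fun_upd_apply) blast
      with False show ?thesis
        by (intro runs_If) (auto elim!: runs_mono)
    qed
  qed (use assms in auto)
  then show ?thesis
    by (rule runs_mono) (auto simp: U_def d_def)
qed

text \<open>Since \<open>\<tau>\<close> is at least 1, the truncated subtraction is exact. For
  \<open>\<tau> = 1\<close> the second pass admits every endpoint that still fits.\<close>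

definition extend :: "vname \<Rightarrow> vname \<Rightarrow> vname \<Rightarrow> vname \<Rightarrow> vname \<Rightarrow> com" where
  "extend u w X Y T =
     Seq (count_degrees u w X Y)
    (Seq (find_threshold T)
    (Seq (add_above u X T)
    (Seq (Assign ''j'' (Sub (Reg ''j'') (Const 1)))
         (add_above u X T))))"

text \<open>The competitors \<open>R\<close> may contain vertices that are not endpoints in
  \<open>u\<close>; these have degree 0 and bring no edges.\<close>

lemma runs_extend:
  assumes "reg s ''m'' = m" "stores_set s T A"
    and "marks (arr s X) (arr s u) m A" "marks (arr s Y) (arr s w) m B"
    and "rreg s ''cap'' = cap" "real (card A) \<le> cap"
    and "distinct [u, w, X, Y, T, ''D'', ''C'']" "T \<noteq> ''i''" "T \<noteq> ''j''" "T \<noteq> ''m''"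
  shows "runs (extend u w X Y T) s (100 + 200 * m)
    (\<lambda>t. agree_except {''i'', ''j'', T} {''D'', ''C'', X, T} s t \<and>
         (\<exists>Z. stores_set t T Z \<and> marks (arr t X) (arr s u) m Z \<and>
              A \<subseteq> Z \<and> Z \<subseteq> A \<union> arr s u ` {..<m} \<and> real (card Z) \<le> cap \<and>
              (\<forall>R. finite R \<longrightarrow> A \<subseteq> R \<longrightarrow> real (card R) \<le> cap \<longrightarrow>
                 edge_count m (arr s u) (arr s w) R B \<le> edge_count m (arr s u) (arr s w) Z B)))"
proof -
  define U W where "U = arr s u" and "W = arr s w"
  define K where "K = U ` {..<m}"
  let ?d = "degree_into m U W B"
  let ?F = "agree_except {''i'', ''j'', T} {''D'', ''C'', X, T} s"
  have A: "reg s T = card A" "finite A"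
    using stores_set_card[OF assms(2)] by auto
  have finK: "finite K" by (simp add: K_def)
  have dist: "u \<noteq> X" "u \<noteq> T" "u \<noteq> ''D''" "u \<noteq> ''C''" "X \<noteq> T" "X \<noteq> ''D''" "X \<noteq> ''C''"
    "T \<noteq> ''D''" "T \<noteq> ''C''" and dist': "distinct [u, X, T, ''D'']"
    using assms(7) by auto
  let ?P1 = "\<lambda>t. agree_except {''i''} {''D'', ''C''} s t \<and>
      (\<forall>v\<in>K - A. arr t ''D'' v = ?d v) \<and>
      (\<forall>j\<in>{1..Suc m}. arr t ''C'' j = card {v \<in> K - A. j \<le> ?d v})"
  have 1: "runs (count_degrees u w X Y) s (30 + 60 * m) ?P1"
    unfolding U_def W_def K_def by (rule runs_count_degrees) (use assms in auto)
  let ?\<tau> = "\<lambda>\<tau>. 1 \<le> \<tau> \<and> real (card {v \<in> K - A. \<tau> \<le> ?d v} + card A) \<le> cap \<and>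
      (1 < \<tau> \<longrightarrow> cap < real (card {v \<in> K - A. \<tau> - 1 \<le> ?d v} + card A))"
  let ?P2 = "\<lambda>t. agree_except {''i'', ''j''} {''D'', ''C''} s t \<and>
      (\<forall>v\<in>K - A. arr t ''D'' v = ?d v) \<and> ?\<tau> (reg t ''j'')"
  have 2: "runs (find_threshold T) t (20 + 20 * m) ?P2" if P1: "?P1 t" for t
  proof -
    have C: "arr t ''C'' j = card {v \<in> K - A. j \<le> ?d v}" if "1 \<le> j" "j \<le> Suc m" for j
      using P1 that by simp
    \<comment> \<open>A degree counts some of the \<open>m\<close> edges, so the counter at
      \<open>m + 1\<close> is 0, as the search requires.\<close>
    have "{v \<in> K - A. Suc m \<le> ?d v} = {}"
      using degree_into_le[of m U W B] by (auto simp: not_less_eq_eq)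
    then have "card {v \<in> K - A. Suc m \<le> ?d v} = 0"
      by (simp only: card.empty)
    then have "arr t ''C'' (Suc m) = 0"
      using C[of "Suc m"] by linarith
    moreover have reg: "reg t T = card A" "rreg t ''cap'' = cap"
      using P1 assms A by (auto simp: agree_except_def)
    ultimately have "runs (find_threshold T) t (20 + 20 * m)
      (\<lambda>t'. agree_except {''j''} {} t t' \<and> reg t' ''j'' \<in> {1..Suc m} \<and>
         real (arr t ''C'' (reg t' ''j'') + reg t T) \<le> rreg t ''cap'' \<and>
         (1 < reg t' ''j'' \<longrightarrow> rreg t ''cap'' < real (arr t ''C'' (reg t' ''j'' - 1) + reg t T)))"
      using assms(6,9) by (intro runs_find_threshold) auto
    then show ?thesis
    proof (rule runs_mono[OF _ order_refl])
      fix t'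
      assume H: "agree_except {''j''} {} t t' \<and> reg t' ''j'' \<in> {1..Suc m} \<and>
         real (arr t ''C'' (reg t' ''j'') + reg t T) \<le> rreg t ''cap'' \<and>
         (1 < reg t' ''j'' \<longrightarrow> rreg t ''cap'' < real (arr t ''C'' (reg t' ''j'' - 1) + reg t T))"
      then have "?\<tau> (reg t' ''j'')"
        using C[of "reg t' ''j''"] C[of "reg t' ''j'' - 1"] reg by auto
      then show "?P2 t'"
        using H P1 by (auto simp: agree_except_def)
    qed
  qed
  let ?Z = "\<lambda>\<theta> A Z. A \<subseteq> Z \<and> Z \<subseteq> A \<union> (K - A) \<and> real (card Z) \<le> cap \<and>
      (\<forall>v\<in>Z - A. \<theta> \<le> ?d v) \<and> (\<forall>v\<in>K - Z. ?d v < \<theta> \<or> cap < real (card Z) + 1)"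
  let ?P3 = "\<lambda>t. ?F t \<and> (\<forall>v\<in>K - A. arr t ''D'' v = ?d v) \<and> ?\<tau> (reg t ''j'') \<and>
      (\<exists>Z. stores_set t T Z \<and> marks (arr t X) U m Z \<and> ?Z (reg t ''j'') A Z)"
  have 3: "runs (add_above u X T) t (10 + 60 * m) ?P3" if P2: "?P2 t" for t
  proof -
    have a: "reg t ''m'' = m" "arr t u = U" "arr t X = arr s X" "rreg t ''cap'' = cap"
      and st: "stores_set t T A"
      using P2 assms dist by (auto simp: agree_except_def U_def stores_set_def)
    have D: "arr t ''D'' v = ?d v" if "v \<in> K - A" for v using P2 that by blast
    have mk: "marks (arr t X) (arr t u) m A"
      using assms(3) a by (simp add: U_def)
    show ?thesis
    proof (rule runs_mono[OF runs_add_above[where s = t, OF a(1) st mk refl a(4) assms(6) dist' assms(8-10)]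
          order_refl], unfold a(2), fold K_def, elim conjE exE)
      fix t' Z
      assume F: "agree_except {''i'', T} {X, T} t t'"
        and Z: "stores_set t' T Z" "marks (arr t' X) U m Z" "A \<subseteq> Z" "Z \<subseteq> A \<union> (K - A)"
          "real (card Z) \<le> cap" "\<forall>v\<in>Z - A. reg t ''j'' \<le> arr t ''D'' v"
          "\<forall>v\<in>K - Z. arr t ''D'' v < reg t ''j'' \<or> cap < real (card Z) + 1"
      \<comment> \<open>\<open>D\<close> holds the true degree only on \<open>K - A\<close>; the
        vertices concerned have to be placed there first.\<close>
      have "reg t ''j'' \<le> ?d v" if "v \<in> Z - A" for v
        using bspec[OF Z(6) that] D[of v] Z(4) that by auto
      moreover have "?d v < reg t ''j'' \<or> cap < real (card Z) + 1" if "v \<in> K - Z" for v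
      proof -
        have "v \<in> K - A" using Z(3) that by blast
        then show ?thesis using bspec[OF Z(7) that] D[of v] by simp
      qed
      ultimately have "?Z (reg t ''j'') A Z" using Z by blast
      moreover have "reg t' ''j'' = reg t ''j''" "arr t' ''D'' = arr t ''D''"
        using F assms(9) dist by (auto simp: agree_except_def)
      moreover have "?F t'"
        using F P2 by (auto simp: agree_except_def)
      ultimately show "?P3 t'"
        using Z(1,2) P2 by auto
    qed
  qed
  \<comment> \<open>The register now holds only \<open>\<tau> - 1\<close>, so \<open>\<tau>\<close>
    itself is kept under an existential quantifier.\<close>
  let ?P4 = "\<lambda>t. ?F t \<and> (\<forall>v\<in>K - A. arr t ''D'' v = ?d v) \<and>
      (\<exists>\<tau> Z. reg t ''j'' = \<tau> - 1 \<and> ?\<tau> \<tau> \<and> stores_set t T Z \<and> marks (arr t X) U m Z \<and> ?Z \<tau> A Z)"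
  have 4: "runs (Assign ''j'' (Sub (Reg ''j'') (Const 1))) t 4 ?P4" if P3: "?P3 t" for t
    using P3 assms(9) by (auto simp: agree_except_def stores_set_def)
  let ?P5 = "\<lambda>t. ?F t \<and>
         (\<exists>Z. stores_set t T Z \<and> marks (arr t X) U m Z \<and>
              A \<subseteq> Z \<and> Z \<subseteq> A \<union> K \<and> real (card Z) \<le> cap \<and>
              (\<forall>R. finite R \<longrightarrow> A \<subseteq> R \<longrightarrow> real (card R) \<le> cap \<longrightarrow>
                 edge_count m U W R B \<le> edge_count m U W Z B))"
  have 5: "runs (add_above u X T) t (10 + 60 * m) ?P5" if P4: "?P4 t" for t
  proof -
    from P4 obtain \<tau> Z1 where \<tau>: "reg t ''j'' = \<tau> - 1" "?\<tau> \<tau>" and st: "stores_set t T Z1"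
      and mk: "marks (arr t X) U m Z1" and Z1: "?Z \<tau> A Z1" by blast
    have F: "?F t" using P4 by blast
    have a: "reg t ''m'' = m" "arr t u = U" "rreg t ''cap'' = cap"
      using F assms dist by (auto simp: agree_except_def U_def)
    have D: "arr t ''D'' v = ?d v" if "v \<in> K - A" for v using P4 that by blast
    have mk': "marks (arr t X) (arr t u) m Z1" using mk a by simp
    have card: "real (card Z1) \<le> cap" using Z1 by blast
    show ?thesis
    proof (rule runs_mono[OF runs_add_above[where s = t, OF a(1) st mk' \<tau>(1) a(3) card dist' assms(8-10)]
          order_refl], unfold a, fold K_def)
      fix t'
      assume H: "agree_except {''i'', T} {X, T} t t' \<and>
         (\<exists>Z. stores_set t' T Z \<and> marks (arr t' X) U m Z \<and>
              Z1 \<subseteq> Z \<and> Z \<subseteq> Z1 \<union> (K - Z1) \<and> real (card Z) \<le> cap \<and>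
              (\<forall>v\<in>Z - Z1. \<tau> - 1 \<le> arr t ''D'' v) \<and>
              (\<forall>v\<in>K - Z. arr t ''D'' v < \<tau> - 1 \<or> cap < real (card Z) + 1))"
      then obtain Z where Z: "stores_set t' T Z" "marks (arr t' X) U m Z"
        "Z1 \<subseteq> Z" "Z \<subseteq> Z1 \<union> (K - Z1)" "real (card Z) \<le> cap"
        "\<forall>v\<in>Z - Z1. \<tau> - 1 \<le> arr t ''D'' v"
        "\<forall>v\<in>K - Z. arr t ''D'' v < \<tau> - 1 \<or> cap < real (card Z) + 1" by blast
      have AZ: "A \<subseteq> Z1" "Z1 \<subseteq> A \<union> K" using Z1 by auto
      have lo: "\<tau> - 1 \<le> ?d v" if "v \<in> Z - Z1" for v
      proof -
        have "v \<in> K - A" using Z(4) AZ that by blast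
        then show ?thesis using bspec[OF Z(6) that] D[of v] by simp
      qed
      have hi: "?d v < \<tau> - 1 \<or> cap < real (card Z) + 1" if "v \<in> K - Z" for v
      proof -
        have "v \<in> K - A" using Z(3) AZ that by blast
        then show ?thesis using bspec[OF Z(7) that] D[of v] by simp
      qed
      have d0: "?d v = 0" if "v \<notin> K" for v
        using that by (simp add: K_def degree_into_eq_0)
      have "sum ?d R \<le> sum ?d Z" if "finite R" "A \<subseteq> R" "real (card R) \<le> cap" for R
        by (rule two_pass_optimal[of A K ?d \<tau> cap Z1 Z R])
          (use A finK d0 \<tau>(2) Z1 AZ Z(3,4,5) lo hi that in auto)
      moreover have "finite Z" using stores_set_card[OF Z(1)] by simp
      ultimately have "edge_count m U W R B \<le> edge_count m U W Z B"
        if "finite R" "A \<subseteq> R" "real (card R) \<le> cap" for R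
        using that by (simp add: edge_count_eq_sum)
      moreover have "?F t'"
        using F H by (auto simp: agree_except_def)
      ultimately show "?P5 t'"
        using Z AZ by (intro conjI exI[of _ Z]) auto
    qed
  qed
  have "runs (extend u w X Y T) s (100 + 200 * m) ?P5"
    unfolding extend_def
    by (rule runs_Seq[OF 1 runs_Seq[OF 2 runs_Seq[OF 3 runs_Seq[OF 4 5 order_refl]
          order_refl] order_refl]]) auto
  then show ?thesis
    unfolding U_def W_def K_def .
qed

section \<open>Consequences of maximal density and the approximation estimate\<close>

section \<open>Densest pairs\<close>

lemma densest_pair_upper:
  assumes dp: "densest_pair G A B" and CD: "C \<subseteq> pverts G" "C \<noteq> {}" "D \<subseteq> pverts G" "D \<noteq> {}"
  shows "density G C D \<le> density G A B"
proof -
  have "\<not> (\<exists>y. (case y of (A, B) \<Rightarrow> A \<subseteq> pverts G \<and> A \<noteq> {} \<and> B \<subseteq> pverts G \<and> B \<noteq> {}) \<and>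
      (case y of (A, B) \<Rightarrow> density G A B) > density G A B)"
    using dp unfolding densest_pair_def is_arg_max_def by simp
  then show ?thesis
    using CD by (simp add: not_less) blast
qed

lemma densest_pair_sets:
  assumes "densest_pair G A B"
  shows "A \<subseteq> pverts G" "A \<noteq> {}" "B \<subseteq> pverts G" "B \<noteq> {}"
  using assms unfolding densest_pair_def is_arg_max_def by auto

lemma edges_between_subset: "edges_between G A B \<subseteq> parcs G"
  by (auto simp: edges_between_def)

context pair_fin_digraph
begin

lemma finite_edges_between: "finite (edges_between G A B)"
  using edges_between_subset pair_finite_arcs by (rule finite_subset)

text \<open>Multiplying out the denominator extends maximality to empty sets, where both sides are
  0. This matters for differences such as \<open>A - S1\<close>, which may be empty.\<close>

lemma card_edges_between_le:
  assumes dp: "densest_pair G A B" and CD: "C \<subseteq> pverts G" "D \<subseteq> pverts G"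
  shows "real (card (edges_between G C D)) \<le> density G A B * sqrt (real (card C) * real (card D))"
proof (cases "C = {} \<or> D = {}")
  case True
  then show ?thesis by (auto simp: edges_between_def)
next
  case False
  have "finite C" "finite D"
    using assms(2,3) pair_finite_verts by (auto intro: finite_subset)
  with False have pos: "sqrt (real (card C) * real (card D)) > 0"
    by (simp add: card_gt_0_iff)
  have "density G C D \<le> density G A B"
    using densest_pair_upper assms False by blast
  with pos show ?thesis by (simp add: density_def[of G C D] pos_divide_le_eq)
qed

text \<open>The two endpoints of any edge form a pair of singletons of density 1.\<close>

lemma densest_pair_edges_pos:
  assumes "densest_pair G A B" "parcs G \<noteq> {}"
  shows "card (edges_between G A B) > 0"
proof -
  from assms(2) obtain u v where e: "(u, v) \<in> parcs G" by auto
  then have uv: "{u} \<subseteq> pverts G" "{v} \<subseteq> pverts G"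
    using arc_fst_in_verts arc_snd_in_verts by fastforce+
  have "edges_between G {u} {v} = {(u, v)}"
    using e by (auto simp: edges_between_def)
  then have "density G {u} {v} = 1"
    by (simp add: density_def)
  with densest_pair_upper[OF assms(1) uv(1) _ uv(2)] have "density G A B > 0"
    by simp
  then show ?thesis
    by (auto simp: density_def zero_less_divide_iff)
qed

text \<open>Otherwise discarding the vertices without an edge to the other side would increase the
  density.\<close>

lemma densest_pair_card_le:
  assumes dp: "densest_pair G A B" and ne: "parcs G \<noteq> {}"
  shows "card A \<le> card (parcs G)" "card B \<le> card (parcs G)"
proof -
  let ?E = "edges_between G A B"
  note sets = densest_pair_sets[OF dp]
  have fin: "finite A" "finite B"
    using sets pair_finite_verts by (auto intro: finite_subset)
  have E: "card ?E > 0" by (rule densest_pair_edges_pos[OF dp ne])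
  have pos: "real (card A) > 0" "real (card B) > 0"
    using sets fin by (auto simp: card_gt_0_iff)
  \<comment> \<open>Shrinking the pair without losing an edge cannot shrink the product of the
    sizes. It is applied with one side cut down to edge endpoints and the other unchanged, whose
    size then cancels.\<close>
  have *: "real (card A) * real (card B) \<le> real (card C) * real (card D)"
    if "C \<subseteq> A" "D \<subseteq> B" "edges_between G C D = ?E" for C D
  proof -
    have CD: "C \<subseteq> pverts G" "D \<subseteq> pverts G" using that sets by auto
    have "real (card ?E) \<le> density G A B * sqrt (real (card C) * real (card D))"
      using card_edges_between_le[OF dp CD] that(3) by simp
    then have "real (card ?E) * sqrt (real (card A) * real (card B))
        \<le> real (card ?E) * sqrt (real (card C) * real (card D))"
      using pos by (simp add: density_def field_simps)
    then show ?thesis using E by simp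
  qed
  have fE: "finite ?E" by (rule finite_edges_between)
  have le: "card ?E \<le> card (parcs G)"
    by (rule card_mono[OF pair_finite_arcs edges_between_subset])
  have "card A \<le> card (fst ` ?E)"
    using *[of "fst ` ?E" B] pos by (force simp: edges_between_def)
  also have "\<dots> \<le> card ?E" by (rule card_image_le[OF fE])
  finally show "card A \<le> card (parcs G)" using le by simp
  have "card B \<le> card (snd ` ?E)"
    using *[of A "snd ` ?E"] pos by (force simp: edges_between_def)
  also have "\<dots> \<le> card ?E" by (rule card_image_le[OF fE])
  finally show "card B \<le> card (parcs G)" using le by simp
qed

end

text \<open>If both sides grow by at most \<open>r = (1 + \<epsilon>) / (1 - \<epsilon>)\<close>, so
  does the geometric mean of their sizes. Together with the lost edges the density keeps a factor
  \<open>(1 - \<epsilon>) / r\<close>, which is at least \<open>1 - 3 * \<epsilon>\<close>.\<close>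

lemma density_ratio_bound:
  fixes E E' \<epsilon> :: real
  assumes "0 \<le> \<epsilon>" "3 * \<epsilon> < 1" "0 < s1" "0 < s2" "0 < a1" "0 < a2" "0 \<le> E'"
    and "(1 - \<epsilon>) * E' \<le> E"
    and a1: "a1 \<le> (1 + \<epsilon>) / (1 - \<epsilon>) * s1" and a2: "a2 \<le> (1 + \<epsilon>) / (1 - \<epsilon>) * s2"
  shows "(1 - 3 * \<epsilon>) * (E' / sqrt (s1 * s2)) \<le> E / sqrt (a1 * a2)"
proof -
  define r where "r = (1 + \<epsilon>) / (1 - \<epsilon>)"
  have r: "r > 0" using assms by (simp add: r_def)
  have "a1 * a2 \<le> (r * s1) * (r * s2)"
    using a1 a2 assms r by (intro mult_mono) (auto simp: r_def)
  then have "sqrt (a1 * a2) \<le> sqrt (r\<^sup>2 * (s1 * s2))"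
    by (simp add: power2_eq_square mult_ac)
  then have q: "sqrt (a1 * a2) \<le> r * sqrt (s1 * s2)"
    using r by (simp add: real_sqrt_mult)
  \<comment> \<open>Both products start with \<open>1 - 2 * \<epsilon>\<close>; the quadratic terms
    have coefficients -3 and 1.\<close>
  have "(1 - 3 * \<epsilon>) * (1 + \<epsilon>) \<le> (1 - \<epsilon>) * (1 - \<epsilon>)"
    using assms(1) by (simp add: algebra_simps)
  then have c: "(1 - 3 * \<epsilon>) * r \<le> 1 - \<epsilon>"
    using assms by (simp add: r_def field_simps)
  have "(1 - 3 * \<epsilon>) * (E' / sqrt (s1 * s2)) * sqrt (a1 * a2) \<le>
      (1 - 3 * \<epsilon>) * (E' / sqrt (s1 * s2)) * (r * sqrt (s1 * s2))"
    using assms q by (intro mult_left_mono) auto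
  also have "\<dots> = ((1 - 3 * \<epsilon>) * r) * E'"
    using assms by (simp add: field_simps)
  also have "\<dots> \<le> (1 - \<epsilon>) * E'"
    using c assms by (intro mult_right_mono) auto
  also have "\<dots> \<le> E" by fact
  finally show ?thesis
    using assms by (simp add: pos_le_divide_eq)
qed

text \<open>The capacity can be computed from \<open>S\<close> alone: \<open>O'\<close> has at most
  \<open>card S / (1 - \<epsilon>')\<close> elements, and at most an \<open>\<epsilon>'\<close>
  fraction of these are missing from \<open>S\<close>. Adding them to \<open>S\<close> gives at most
  \<open>card S / (1 - \<epsilon>')\<close> again.\<close>

lemma near_opt_sizes:
  fixes \<epsilon> \<epsilon>' :: real
  assumes "finite S" "finite O'" "O' \<noteq> {}" "\<epsilon>' \<le> \<epsilon>" "3 * \<epsilon> < 1"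
    and near: "real (card (S \<inter> O')) \<ge> (1 - \<epsilon>') * real (card O')"
      "real (card (S - O')) \<le> \<epsilon>' * real (card O')"
  shows "0 \<le> \<epsilon>'" "S \<noteq> {}" "real (card (S \<union> O')) \<le> real (card S) / (1 - \<epsilon>')"
    "real (card S) / (1 - \<epsilon>') \<le> (1 + \<epsilon>) / (1 - \<epsilon>) * real (card O')"
    "real (card (O' - S)) \<le> \<epsilon> * real (card O')"
    "card S \<le> 2 * card O'"
proof -
  have pos: "real (card O') > 0" using assms by (simp add: card_gt_0_iff)
  have S: "card S = card (S \<inter> O') + card (S - O')"
    using assms(1) by (metis card_Int_Diff)
  have O: "card O' = card (S \<inter> O') + card (O' - S)"
    using assms(2) by (metis card_Int_Diff Int_commute)
  have U: "card (S \<union> O') = card S + card (O' - S)"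
    using assms(1,2) by (subst card_Un_disjoint[symmetric]) (auto intro: arg_cong[of _ _ card])
  \<comment> \<open>A negative \<open>\<epsilon>'\<close> would make the bound on
    \<open>card (S - O')\<close> negative, since \<open>O'\<close> is nonempty.\<close>
  show e: "0 \<le> \<epsilon>'"
    using near(2) pos by (smt (verit) mult_neg_pos of_nat_0_le_iff)
  have e': "\<epsilon>' < 1" using assms by simp
  have "(1 - \<epsilon>') * real (card O') > 0" using e' pos by simp
  then show "S \<noteq> {}" using near(1) by auto
  have D: "real (card (O' - S)) \<le> \<epsilon>' * real (card O')"
    using near(1) O by (simp add: algebra_simps)
  also have "\<dots> \<le> \<epsilon> * real (card O')"
    using assms(4) by (intro mult_right_mono) auto
  finally show "real (card (O' - S)) \<le> \<epsilon> * real (card O')" .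
  have lo: "(1 - \<epsilon>') * real (card O') \<le> real (card S)"
    using near(1) S by simp
  have "(1 - \<epsilon>') * real (card (O' - S)) \<le> (1 - \<epsilon>') * (\<epsilon>' * real (card O'))"
    using D e' by (intro mult_left_mono) auto
  then have "(1 - \<epsilon>') * real (card (S \<union> O')) \<le>
      (1 - \<epsilon>') * real (card S) + (1 - \<epsilon>') * (\<epsilon>' * real (card O'))"
    unfolding U by (simp add: algebra_simps)
  also have "\<dots> \<le> (1 - \<epsilon>') * real (card S) + \<epsilon>' * real (card S)"
    using mult_left_mono[OF lo e] by (simp add: algebra_simps)
  finally show "real (card (S \<union> O')) \<le> real (card S) / (1 - \<epsilon>')"
    using e' by (simp add: pos_le_divide_eq algebra_simps)
  have hi: "real (card S) \<le> (1 + \<epsilon>') * real (card O')"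
    using near(2) S O by (simp add: algebra_simps)
  have "real (card S) / (1 - \<epsilon>') \<le> ((1 + \<epsilon>') * real (card O')) / (1 - \<epsilon>')"
    using hi e' by (intro divide_right_mono) auto
  also have "\<dots> \<le> ((1 + \<epsilon>) * real (card O')) / (1 - \<epsilon>)"
    using assms(4,5) e by (intro frac_le mult_right_mono) auto
  finally show "real (card S) / (1 - \<epsilon>') \<le> (1 + \<epsilon>) / (1 - \<epsilon>) * real (card O')"
    by simp
  have "(1 + \<epsilon>') * real (card O') \<le> 2 * real (card O')"
    using e' by (intro mult_right_mono) auto
  then show "card S \<le> 2 * card O'" using hi by linarith
qed

text \<open>The missed edges, between \<open>A - S1\<close> and \<open>B - S2\<close>, number at most an \<open>\<epsilon>\<close> fraction because that
  pair is itself no denser than the optimum.\<close>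

lemma (in pair_fin_digraph) extended_pair_density:
  fixes \<epsilon> :: real
  assumes dp: "densest_pair G A B"
    and \<epsilon>: "0 \<le> \<epsilon>" "3 * \<epsilon> < 1"
    and T: "finite T1" "T1 \<noteq> {}" "finite T2" "T2 \<noteq> {}" "S1 \<subseteq> T1"
    and miss: "real (card (A - S1)) \<le> \<epsilon> * real (card A)"
      "real (card (B - S2)) \<le> \<epsilon> * real (card B)"
    and size: "real (card T1) \<le> (1 + \<epsilon>) / (1 - \<epsilon>) * real (card A)"
      "real (card T2) \<le> (1 + \<epsilon>) / (1 - \<epsilon>) * real (card B)"
    and ext1: "card (edges_between G (S1 \<union> A) S2) \<le> card (edges_between G T1 S2)"
    and ext2: "card (edges_between G T1 (S2 \<union> B)) \<le> card (edges_between G T1 T2)"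
  shows "(1 - 3 * \<epsilon>) * density G A B \<le> density G T1 T2"
proof -
  let ?e = "\<lambda>X Y. card (edges_between G X Y)"
  note sets = densest_pair_sets[OF dp]
  have fin: "finite A" "finite B"
    using sets pair_finite_verts by (auto intro: finite_subset)
  have pos: "real (card A) > 0" "real (card B) > 0" "real (card T1) > 0" "real (card T2) > 0"
    using sets fin T by (auto simp: card_gt_0_iff)
  \<comment> \<open>An optimal edge ends in \<open>S2\<close>, or it ends in \<open>B - S2\<close>
    and starts in \<open>S1\<close> or in \<open>A - S1\<close>. The extensions account for the
    first two kinds; the third kind is lost.\<close>
  have "?e A B \<le> card ((edges_between G (S1 \<union> A) S2 \<union> edges_between G S1 (B - S2))
      \<union> edges_between G (A - S1) (B - S2))"
    by (rule card_mono) (auto simp: finite_edges_between, auto simp: edges_between_def)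
  also have "\<dots> \<le> (?e (S1 \<union> A) S2 + ?e S1 (B - S2)) + ?e (A - S1) (B - S2)"
    by (meson card_Un_le add_mono order_refl order_trans)
  finally have cover: "?e A B \<le> ?e (S1 \<union> A) S2 + ?e S1 (B - S2) + ?e (A - S1) (B - S2)" .
  have "?e S1 (B - S2) \<le> ?e T1 (B - S2)"
    by (rule card_mono[OF finite_edges_between]) (use T(5) in \<open>auto simp: edges_between_def\<close>)
  \<comment> \<open>Both kinds of edges are now counted inside \<open>(T1, S2 \<union> B)\<close>,
    the pair with which the second extension is compared.\<close>
  moreover have "?e T1 S2 + ?e T1 (B - S2) = ?e T1 (S2 \<union> B)"
    by (subst card_Un_disjoint[symmetric])
      (auto simp: finite_edges_between, auto simp: edges_between_def intro: arg_cong[of _ _ card])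
  ultimately have main: "?e A B \<le> ?e T1 T2 + ?e (A - S1) (B - S2)"
    using cover ext1 ext2 by linarith
  have "real (card (A - S1)) * real (card (B - S2)) \<le> (\<epsilon> * real (card A)) * (\<epsilon> * real (card B))"
    using miss \<epsilon> by (intro mult_mono) auto
  then have "sqrt (real (card (A - S1)) * real (card (B - S2)))
      \<le> sqrt (\<epsilon>\<^sup>2 * (real (card A) * real (card B)))"
    by (simp add: power2_eq_square mult_ac)
  then have sq: "sqrt (real (card (A - S1)) * real (card (B - S2)))
      \<le> \<epsilon> * sqrt (real (card A) * real (card B))"
    using \<epsilon> by (simp add: real_sqrt_mult)
  have "real (?e (A - S1) (B - S2))
      \<le> density G A B * sqrt (real (card (A - S1)) * real (card (B - S2)))"
    by (rule card_edges_between_le[OF dp]) (use sets in auto)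
  also have "\<dots> \<le> density G A B * (\<epsilon> * sqrt (real (card A) * real (card B)))"
    using sq by (intro mult_left_mono) (auto simp: density_def)
  also have "\<dots> = \<epsilon> * real (?e A B)"
    using pos by (simp add: density_def)
  finally have "(1 - \<epsilon>) * real (?e A B) \<le> real (?e T1 T2)"
    using main by (simp add: algebra_simps)
  then show ?thesis
    unfolding density_def using \<epsilon> pos size by (intro density_ratio_bound) auto
qed

lemma card_edges_between_eq_edge_count:
  assumes "bij_betw (\<lambda>i. (U i, W i)) {..<m} (parcs G)"
  shows "card (edges_between G A B) = edge_count m U W A B"
proof -
  let ?I = "{i. i < m \<and> U i \<in> A \<and> W i \<in> B}"
  have arcs: "parcs G = (\<lambda>i. (U i, W i)) ` {..<m}"
    using assms by (simp add: bij_betw_def)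
  have "edges_between G A B = (\<lambda>i. (U i, W i)) ` ?I"
    unfolding edges_between_def arcs by auto
  moreover have "inj_on (\<lambda>i. (U i, W i)) ?I"
    using assms by (auto simp: bij_betw_def intro: inj_on_subset)
  ultimately have "bij_betw (\<lambda>i. (U i, W i)) ?I (edges_between G A B)"
    by (simp add: bij_betw_def)
  then show ?thesis
    unfolding edge_count_def using bij_betw_same_card by fastforce
qed


section \<open>The complete program, its linear running time and its guarantee\<close>

section \<open>The algorithm\<close>

text \<open>Vertex 0 exists because the vertices form an initial segment of the naturals and the
  optimal sets are nonempty.\<close>

definition trivial_pair :: com where
  "trivial_pair =
     Seq (Store ''T1'' (Const 0) (Const 0))
    (Seq (Assign ''T1'' (Const 1))
    (Seq (Store ''T2'' (Const 0) (Const 0))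
         (Assign ''T2'' (Const 1))))"

text \<open>The order matters: the first extension uses the marks of the original \<open>S2\<close>,
  whereas the second finds in \<open>X1\<close> the marks of the already extended \<open>T1\<close>.
  Register \<open>T2\<close> still holds the size of \<open>S2\<close> when its capacity is
  computed.\<close>

definition extended_pair :: com where
  "extended_pair =
     Seq (load_set ''src'' ''X1'' ''S1'' ''T1'')
    (Seq (load_set ''dst'' ''X2'' ''S2'' ''T2'')
    (Seq (RAssign ''cap''
           (RDiv (RNat (Reg ''T1'')) (RSub (RNat (Const 1)) (RReg ''eps1''))))
    (Seq (extend ''src'' ''dst'' ''X1'' ''X2'' ''T1'')
    (Seq (RAssign ''cap''
           (RDiv (RNat (Reg ''T2'')) (RSub (RNat (Const 1)) (RReg ''eps2''))))
         (extend ''dst'' ''src'' ''X2'' ''X1'' ''T2'')))))"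

definition small_eps :: "vname \<Rightarrow> bexp" where
  "small_eps e = RLess (RMul (RNat (Const 3)) (RReg e)) (RNat (Const 1))"

text \<open>Strict comparison with \<open>2 * m + 1\<close> expresses size at most
  \<open>2 * m\<close>, which keeps loading linear in \<open>m\<close>.\<close>

definition few :: "vname \<Rightarrow> bexp" where
  "few S = Less (Reg S) (Add (Add (Reg ''m'') (Reg ''m'')) (Const 1))"

definition guard :: bexp where
  "guard = Conj (Less (Const 0) (Reg ''m''))
    (Conj (Conj (few ''S1'') (few ''S2'')) (Conj (small_eps ''eps1'') (small_eps ''eps2'')))"

lemma runs_trivial_pair:
  "runs trivial_pair s 20 (\<lambda>t. stores_set t ''T1'' {0} \<and> stores_set t ''T2'' {0})"
  unfolding trivial_pair_def
  by (intro runs_Seq_Assign runs_Seq_Store)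
    (simp_all add: stores_set_def bij_betw_def lessThan_Suc)

lemma runs_extended_pair:
  fixes \<epsilon>1 \<epsilon>2 :: real
  assumes "reg s ''m'' = m" "stores_set s ''S1'' A" "stores_set s ''S2'' B"
    and eps: "rreg s ''eps1'' = \<epsilon>1" "rreg s ''eps2'' = \<epsilon>2"
      "0 \<le> \<epsilon>1" "\<epsilon>1 < 1" "0 \<le> \<epsilon>2" "\<epsilon>2 < 1"
    and small: "card A \<le> 2 * m" "card B \<le> 2 * m"
  defines "cap1 \<equiv> real (card A) / (1 - \<epsilon>1)" and "cap2 \<equiv> real (card B) / (1 - \<epsilon>2)"
  defines "cnt \<equiv> edge_count m (arr s ''src'') (arr s ''dst'')"
  shows "runs extended_pair s (400 + 600 * m) (\<lambda>t. \<exists>T1 T2.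
    stores_set t ''T1'' T1 \<and> stores_set t ''T2'' T2 \<and>
    A \<subseteq> T1 \<and> T1 \<subseteq> A \<union> arr s ''src'' ` {..<m} \<and> real (card T1) \<le> cap1 \<and>
    (\<forall>R. finite R \<longrightarrow> A \<subseteq> R \<longrightarrow> real (card R) \<le> cap1 \<longrightarrow> cnt R B \<le> cnt T1 B) \<and>
    B \<subseteq> T2 \<and> T2 \<subseteq> B \<union> arr s ''dst'' ` {..<m} \<and> real (card T2) \<le> cap2 \<and>
    (\<forall>R. finite R \<longrightarrow> B \<subseteq> R \<longrightarrow> real (card R) \<le> cap2 \<longrightarrow> cnt T1 R \<le> cnt T1 T2))"
proof -
  define U W where "U = arr s ''src''" and "W = arr s ''dst''"
  let ?same = "\<lambda>t. reg t ''m'' = m \<and> arr t ''src'' = U \<and> arr t ''dst'' = W \<and>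
    rreg t ''eps1'' = \<epsilon>1 \<and> rreg t ''eps2'' = \<epsilon>2"
  have A: "reg s ''S1'' = card A" "finite A" and B: "reg s ''S2'' = card B" "finite B"
    using stores_set_card assms(2,3) by metis+
  have same: "?same s" using assms by (simp add: U_def W_def)
  let ?P1 = "\<lambda>t. ?same t \<and> stores_set t ''S2'' B \<and>
    stores_set t ''T1'' A \<and> marks (arr t ''X1'') U m A"
  have 1: "runs (load_set ''src'' ''X1'' ''S1'' ''T1'') s (30 + 20 * m + 20 * card A) ?P1"
    by (rule runs_mono[OF runs_load_set[OF assms(2,1) A(1)] order_refl])
      (use same assms(3) in \<open>auto simp: agree_except_def stores_set_def\<close>)
  let ?P2 = "\<lambda>t. ?same t \<and> stores_set t ''T1'' A \<and> marks (arr t ''X1'') U m A \<and>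
    stores_set t ''T2'' B \<and> marks (arr t ''X2'') W m B"
  have 2: "runs (load_set ''dst'' ''X2'' ''S2'' ''T2'') t (30 + 20 * m + 20 * card B) ?P2"
    if P1: "?P1 t" for t
  proof -
    have "stores_set t ''S2'' B" "reg t ''m'' = m" "reg t ''S2'' = card B"
      using P1 stores_set_card[of t "''S2''" B] by auto
    then show ?thesis
      by (rule runs_mono[OF runs_load_set order_refl])
        (use P1 in \<open>auto simp: agree_except_def stores_set_def\<close>)
  qed
  let ?P3 = "\<lambda>t. ?P2 t \<and> rreg t ''cap'' = cap1"
  have 3: "runs (RAssign ''cap''
      (RDiv (RNat (Reg ''T1'')) (RSub (RNat (Const 1)) (RReg ''eps1'')))) t 10 ?P3"
    if P2: "?P2 t" for t
    using P2 stores_set_card[of t "''T1''" A] by (auto simp: stores_set_def cap1_def)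
  let ?ext1 = "\<lambda>T1. A \<subseteq> T1 \<and> T1 \<subseteq> A \<union> U ` {..<m} \<and> real (card T1) \<le> cap1 \<and>
    (\<forall>R. finite R \<longrightarrow> A \<subseteq> R \<longrightarrow> real (card R) \<le> cap1 \<longrightarrow> edge_count m U W R B \<le> edge_count m U W T1 B)"
  let ?P4 = "\<lambda>t. ?same t \<and> stores_set t ''T2'' B \<and> marks (arr t ''X2'') W m B \<and>
    (\<exists>T1. stores_set t ''T1'' T1 \<and> marks (arr t ''X1'') U m T1 \<and> ?ext1 T1)"
  \<comment> \<open>Division by a number in (0, 1] does not decrease the size, so the unextended
    sets fit.\<close>
  have cap: "real (card A) \<le> cap1" "real (card B) \<le> cap2"
    using eps by (auto simp: cap1_def cap2_def pos_le_divide_eq mult_left_le)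
  have 4: "runs (extend ''src'' ''dst'' ''X1'' ''X2'' ''T1'') t (100 + 200 * m) ?P4"
    if P3: "?P3 t" for t
  proof -
    have "runs (extend ''src'' ''dst'' ''X1'' ''X2'' ''T1'') t (100 + 200 * m)
      (\<lambda>t'. agree_except {''i'', ''j'', ''T1''} {''D'', ''C'', ''X1'', ''T1''} t t' \<and>
         (\<exists>Z. stores_set t' ''T1'' Z \<and> marks (arr t' ''X1'') (arr t ''src'') m Z \<and>
              A \<subseteq> Z \<and> Z \<subseteq> A \<union> arr t ''src'' ` {..<m} \<and> real (card Z) \<le> cap1 \<and>
              (\<forall>R. finite R \<longrightarrow> A \<subseteq> R \<longrightarrow> real (card R) \<le> cap1 \<longrightarrow>
                 edge_count m (arr t ''src'') (arr t ''dst'') R B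
                   \<le> edge_count m (arr t ''src'') (arr t ''dst'') Z B)))"
      by (rule runs_extend) (use P3 cap in auto)
    then show ?thesis
      by (rule runs_mono[OF _ order_refl])
        (use P3 in \<open>auto simp: agree_except_def stores_set_def\<close>)
  qed
  let ?P5 = "\<lambda>t. ?P4 t \<and> rreg t ''cap'' = cap2"
  have 5: "runs (RAssign ''cap''
      (RDiv (RNat (Reg ''T2'')) (RSub (RNat (Const 1)) (RReg ''eps2'')))) t 10 ?P5"
    if P4: "?P4 t" for t
    using P4 stores_set_card[of t "''T2''" B] by (auto simp: stores_set_def cap2_def)
  let ?P6 = "\<lambda>t. \<exists>T1 T2. stores_set t ''T1'' T1 \<and> stores_set t ''T2'' T2 \<and> ?ext1 T1 \<and>
    B \<subseteq> T2 \<and> T2 \<subseteq> B \<union> W ` {..<m} \<and> real (card T2) \<le> cap2 \<and>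
    (\<forall>R. finite R \<longrightarrow> B \<subseteq> R \<longrightarrow> real (card R) \<le> cap2 \<longrightarrow> edge_count m U W T1 R \<le> edge_count m U W T1 T2)"
  have 6: "runs (extend ''dst'' ''src'' ''X2'' ''X1'' ''T2'') t (100 + 200 * m) ?P6"
    if P5: "?P5 t" for t
  proof -
    from P5 obtain T1 where T1: "stores_set t ''T1'' T1" "marks (arr t ''X1'') U m T1" "?ext1 T1"
      by blast
    have "runs (extend ''dst'' ''src'' ''X2'' ''X1'' ''T2'') t (100 + 200 * m)
      (\<lambda>t'. agree_except {''i'', ''j'', ''T2''} {''D'', ''C'', ''X2'', ''T2''} t t' \<and>
         (\<exists>Z. stores_set t' ''T2'' Z \<and> marks (arr t' ''X2'') (arr t ''dst'') m Z \<and>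
              B \<subseteq> Z \<and> Z \<subseteq> B \<union> arr t ''dst'' ` {..<m} \<and> real (card Z) \<le> cap2 \<and>
              (\<forall>R. finite R \<longrightarrow> B \<subseteq> R \<longrightarrow> real (card R) \<le> cap2 \<longrightarrow>
                 edge_count m (arr t ''dst'') (arr t ''src'') R T1
                   \<le> edge_count m (arr t ''dst'') (arr t ''src'') Z T1)))"
      by (rule runs_extend) (use P5 T1 cap in auto)
    then show ?thesis
    proof (rule runs_mono[OF _ order_refl], elim conjE exE)
      fix t' Z
      assume F: "agree_except {''i'', ''j'', ''T2''} {''D'', ''C'', ''X2'', ''T2''} t t'"
        and Z: "stores_set t' ''T2'' Z" "B \<subseteq> Z" "Z \<subseteq> B \<union> arr t ''dst'' ` {..<m}"
          "real (card Z) \<le> cap2"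
          "\<forall>R. finite R \<longrightarrow> B \<subseteq> R \<longrightarrow> real (card R) \<le> cap2 \<longrightarrow>
                 edge_count m (arr t ''dst'') (arr t ''src'') R T1
                   \<le> edge_count m (arr t ''dst'') (arr t ''src'') Z T1"
      have "stores_set t' ''T1'' T1"
        using F T1(1) by (simp add: agree_except_def stores_set_def)
      \<comment> \<open>The second extension counts edges with the endpoint arrays exchanged, hence
        the swap.\<close>
      with T1(3) Z P5 show "?P6 t'"
        by (intro exI[of _ T1] exI[of _ Z]) (simp add: edge_count_swap[of m U W])
    qed
  qed
  \<comment> \<open>For sets of size at most \<open>2 * m\<close> the two loads cost at most
    \<open>60 + 120 * m\<close>; the extensions and capacities cost
    \<open>220 + 400 * m\<close>.\<close>
  have "runs extended_pair s (400 + 600 * m) ?P6"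
    unfolding extended_pair_def
    by (rule runs_Seq[OF 1 runs_Seq[OF 2 runs_Seq[OF 3 runs_Seq[OF 4 runs_Seq[OF 5 6 order_refl]
          order_refl] order_refl] order_refl]]) (use small in auto)
  then show ?thesis
    unfolding cnt_def U_def W_def by (simp only: conj_assoc)
qed

theorem theorem2:
  shows "\<exists>(p :: com) (time :: nat \<Rightarrow> nat) (c :: real).
    (\<lambda>m. real (time m)) \<in> O(\<lambda>m. real m) \<and>
    (\<forall>(G :: nat pair_pre_digraph) (n :: nat) (m :: nat) S1opt S2opt S1 S2
       (\<epsilon>1 :: real) (\<epsilon>2 :: real) (s :: state).
      pair_fin_digraph G \<longrightarrow>
      pverts G = {..<n} \<longrightarrow>
      card (parcs G) = m \<longrightarrow>
      densest_pair G S1opt S2opt \<longrightarrow>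
      S1 \<subseteq> pverts G \<longrightarrow>
      S2 \<subseteq> pverts G \<longrightarrow>
      real (card (S1 \<inter> S1opt)) \<ge> (1 - \<epsilon>1) * real (card S1opt) \<longrightarrow>
      real (card (S2 \<inter> S2opt)) \<ge> (1 - \<epsilon>2) * real (card S2opt) \<longrightarrow>
      real (card (S1 - S1opt)) \<le> \<epsilon>1 * real (card S1opt) \<longrightarrow>
      real (card (S2 - S2opt)) \<le> \<epsilon>2 * real (card S2opt) \<longrightarrow>
      stores_input s G S1 S2 \<epsilon>1 \<epsilon>2 \<longrightarrow>
      (\<exists>t s' T1 T2.
        exec p s t s' \<and> t \<le> time m \<and>
        stores_set s' ''T1'' T1 \<and> T1 \<subseteq> pverts G \<and> T1 \<noteq> {} \<and>
        stores_set s' ''T2'' T2 \<and> T2 \<subseteq> pverts G \<and> T2 \<noteq> {} \<and>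
        density G T1 T2 \<ge> (1 - c * max \<epsilon>1 \<epsilon>2) * density G S1opt S2opt))"
\<comment> \<open>The constant 3 is the one of \<open>density_ratio_bound\<close>; the additive 500
  also covers the guard.\<close>
proof (rule exI[of _ "If guard extended_pair trivial_pair"],
    rule exI[of _ "\<lambda>m. 500 + 600 * m"], rule exI[of _ 3], intro conjI allI impI)
  show "(\<lambda>m. real (500 + 600 * m)) \<in> O(\<lambda>m. real m)"
    by (rule bigoI[of _ 1100]) (auto intro!: eventually_sequentiallyI[of 1])
next
  fix G :: "nat pair_pre_digraph" and n m S1opt S2opt S1 S2 and \<epsilon>1 \<epsilon>2 :: real and s :: state
  assume G: "pair_fin_digraph G" and V: "pverts G = {..<n}" and m: "card (parcs G) = m"
    and dp: "densest_pair G S1opt S2opt" and S: "S1 \<subseteq> pverts G" "S2 \<subseteq> pverts G"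
    and near1: "real (card (S1 \<inter> S1opt)) \<ge> (1 - \<epsilon>1) * real (card S1opt)"
    and near2: "real (card (S2 \<inter> S2opt)) \<ge> (1 - \<epsilon>2) * real (card S2opt)"
    and near1': "real (card (S1 - S1opt)) \<le> \<epsilon>1 * real (card S1opt)"
    and near2': "real (card (S2 - S2opt)) \<le> \<epsilon>2 * real (card S2opt)"
    and input: "stores_input s G S1 S2 \<epsilon>1 \<epsilon>2"
  interpret pair_fin_digraph G by fact
  define \<epsilon> where "\<epsilon> = max \<epsilon>1 \<epsilon>2"
  let ?ok = "\<lambda>s'. \<exists>T1 T2.
        stores_set s' ''T1'' T1 \<and> T1 \<subseteq> pverts G \<and> T1 \<noteq> {} \<and>
        stores_set s' ''T2'' T2 \<and> T2 \<subseteq> pverts G \<and> T2 \<noteq> {} \<and>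
        density G T1 T2 \<ge> (1 - 3 * \<epsilon>) * density G S1opt S2opt"
  note opt = densest_pair_sets[OF dp]
  have fin: "finite S1" "finite S2" "finite S1opt" "finite S2opt"
    using S opt pair_finite_verts by (auto intro: finite_subset)
  have in_regs: "reg s ''m'' = m" "stores_set s ''S1'' S1" "stores_set s ''S2'' S2"
    "rreg s ''eps1'' = \<epsilon>1" "rreg s ''eps2'' = \<epsilon>2"
    and bij: "bij_betw (\<lambda>i. (arr s ''src'' i, arr s ''dst'' i)) {..<m} (parcs G)"
    using input m by (auto simp: stores_input_def)
  have sizes: "reg s ''S1'' = card S1" "reg s ''S2'' = card S2"
    using in_regs stores_set_card by metis+
  have guard: "bval guard s \<longleftrightarrow> 0 < m \<and> card S1 \<le> 2 * m \<and> card S2 \<le> 2 * m \<and> 3 * \<epsilon> < 1"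
    by (auto simp: guard_def few_def small_eps_def in_regs sizes \<epsilon>_def)
  have "runs (If guard extended_pair trivial_pair) s (500 + 600 * m) ?ok"
  proof (cases "3 * \<epsilon> < 1 \<and> 0 < m")
    case True
    then have \<epsilon>3: "3 * \<epsilon> < 1" and ne: "parcs G \<noteq> {}" using m by auto
    have le: "\<epsilon>1 \<le> \<epsilon>" "\<epsilon>2 \<le> \<epsilon>" by (auto simp: \<epsilon>_def)
    note n1 = near_opt_sizes[OF fin(1,3) opt(2) le(1) \<epsilon>3 near1 near1']
    note n2 = near_opt_sizes[OF fin(2,4) opt(4) le(2) \<epsilon>3 near2 near2']
    \<comment> \<open>Each given set is at most twice as large as the optimal one, which has at most
      \<open>m\<close> vertices. So the guard succeeds.\<close>
    have small: "card S1 \<le> 2 * m" "card S2 \<le> 2 * m"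
      using n1(6) n2(6) densest_pair_card_le[OF dp ne] m by auto
    have g: "bval guard s" using guard True small by blast
    have lt1: "\<epsilon>1 < 1" "\<epsilon>2 < 1" using \<epsilon>3 le n1(1) by auto
    have cnt: "edge_count m (arr s ''src'') (arr s ''dst'') X Y = card (edges_between G X Y)" for X Y
      using card_edges_between_eq_edge_count[OF bij] by simp
    have verts: "arr s ''src'' ` {..<m} \<subseteq> pverts G" "arr s ''dst'' ` {..<m} \<subseteq> pverts G"
      using bij arc_fst_in_verts arc_snd_in_verts by (fastforce simp: bij_betw_def)+
    note run = runs_extended_pair[OF in_regs n1(1) lt1(1) n2(1) lt1(2) small, unfolded cnt]
    have "runs extended_pair s (400 + 600 * m) ?ok"
    proof (rule runs_mono[OF run order_refl], elim exE conjE)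
      fix s' T1 T2
      assume st: "stores_set s' ''T1'' T1" "stores_set s' ''T2'' T2"
        and T1: "S1 \<subseteq> T1" "T1 \<subseteq> S1 \<union> arr s ''src'' ` {..<m}"
          "real (card T1) \<le> real (card S1) / (1 - \<epsilon>1)"
        and T2: "S2 \<subseteq> T2" "T2 \<subseteq> S2 \<union> arr s ''dst'' ` {..<m}"
          "real (card T2) \<le> real (card S2) / (1 - \<epsilon>2)"
        and ext1: "\<forall>R. finite R \<longrightarrow> S1 \<subseteq> R \<longrightarrow> real (card R) \<le> real (card S1) / (1 - \<epsilon>1) \<longrightarrow>
          card (edges_between G R S2) \<le> card (edges_between G T1 S2)"
        and ext2: "\<forall>R. finite R \<longrightarrow> S2 \<subseteq> R \<longrightarrow> real (card R) \<le> real (card S2) / (1 - \<epsilon>2) \<longrightarrow>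
          card (edges_between G T1 R) \<le> card (edges_between G T1 T2)"
      have T: "finite T1" "T1 \<noteq> {}" "finite T2" "T2 \<noteq> {}"
        using st stores_set_card T1(1) T2(1) n1(2) n2(2) by auto
      have "(1 - 3 * \<epsilon>) * density G S1opt S2opt \<le> density G T1 T2"
      proof (rule extended_pair_density[OF dp _ \<epsilon>3 T T1(1) n1(5) n2(5)])
        \<comment> \<open>\<open>S1 \<union> S1opt\<close> respects the capacity, so it is one of
          the competitors that \<open>T1\<close> beats.\<close>
        show "card (edges_between G (S1 \<union> S1opt) S2) \<le> card (edges_between G T1 S2)"
          using ext1 n1(3) fin by auto
        show "card (edges_between G T1 (S2 \<union> S2opt)) \<le> card (edges_between G T1 T2)"
          using ext2 n2(3) fin by auto
      qed (use n1(1,4) n2(4) le T1(3) T2(3) in auto)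
      moreover have "T1 \<subseteq> pverts G"
        using T1(2) S(1) verts(1) by blast
      moreover have "T2 \<subseteq> pverts G"
        using T2(2) S(2) verts(2) by blast
      ultimately show "?ok s'" using st T by blast
    qed
    then show ?thesis
      by (intro runs_If) (use g in \<open>auto elim!: runs_mono simp: guard_def few_def small_eps_def\<close>)
  next
    case False
    \<comment> \<open>Either there are no edges and the optimum is 0, or the factor is not positive;
      any nonempty pair then meets the bound.\<close>
    have "(1 - 3 * \<epsilon>) * density G S1opt S2opt \<le> 0"
    proof (cases "m = 0")
      case True
      then have "parcs G = {}" using m pair_finite_arcs by simp
      then show ?thesis by (simp add: density_def edges_between_def)
    next
      case m0: False
      with False show ?thesis
        by (intro mult_nonpos_nonneg) (auto simp: density_def)
    qed
    also have "0 \<le> density G {0} {0}" by (simp add: density_def)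
    finally have "(1 - 3 * \<epsilon>) * density G S1opt S2opt \<le> density G {0} {0}" .
    moreover have "{0} \<subseteq> pverts G" using V opt(1,2) by auto
    ultimately have "runs trivial_pair s 20 ?ok"
      by (intro runs_mono[OF runs_trivial_pair order_refl]) blast
    moreover have "\<not> bval guard s" using guard False by blast
    ultimately show ?thesis
      by (intro runs_If) (auto elim!: runs_mono simp: guard_def few_def small_eps_def)
  qed
  then show "\<exists>t s' T1 T2.
        exec (If guard extended_pair trivial_pair) s t s' \<and> t \<le> 500 + 600 * m \<and>
        stores_set s' ''T1'' T1 \<and> T1 \<subseteq> pverts G \<and> T1 \<noteq> {} \<and>
        stores_set s' ''T2'' T2 \<and> T2 \<subseteq> pverts G \<and> T2 \<noteq> {} \<and>
        density G T1 T2 \<ge> (1 - 3 * max \<epsilon>1 \<epsilon>2) * density G S1opt S2opt"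
    unfolding runs_def \<epsilon>_def by blast
qed

end
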